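(* Let $A=(A_{ij})$, $B=(B_{ij})$ be $m\times n$ matrices with entries in $\mathbb{R}\cup\{-\infty\}$ and let $c,d\in(\mathbb{R}\cup\{-\infty\})^m$. Let $\hat A$, $\hat B$ be the $m\times(n+1)$ matrices obtained by completing $A$ and $B$ with an $(n+1)$-th column given by $\hat A_{i,n+1}=c_i$ and $\hat B_{i,n+1}=d_i$ for all $i\in[m]$. For $y\in(\mathbb{R}\cup\{-\infty\})^{n+1}$ define $\hat f(y)$ by $$\hat f_j(y)=\min_{i\in[m]}\Bigl(-\hat A_{ij}+\max_{k\in[n+1]}(\hat B_{ik}+y_k)\Bigr),\qquad j\in[n+1].$$ Then the tropical polyhedron $$P=\Bigl\{x\in(\mathbb{R}\cup\{-\infty\})^n:\max\bigl(\max_{j\in[n]}(A_{ij}+x_j),c_i\bigr)\leq\max\bigl(\max_{j\in[n]}(B_{ij}+x_j),d_i\bigr)\ \forall i\in[m]\Bigr\}$$ is nonempty if and only if the value of the mean payoff game with dynamic programming operator $\hat f$, starting from the initial state $n+1$, is nonnegative, i.e., $\chi_{n+1}(\hat f)\geq0$.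
   Context: Write $[n]=\{1,\dots,n\}$. In the definition of $\hat f$ the convention is $(+\infty)+(-\infty)=+\infty$ when $-\hat A_{ij}$ is added to the inner maximum, so indices $i$ with $\hat A_{ij}=-\infty$ do not contribute to the minimum. The mean payoff game with dynamic programming operator $\hat f$ is the following. Two players, Max and Min, alternate moves on the disjoint union of $[m]$ and $[n+1]$. In state $j\in[n+1]$, Min chooses $i\in[m]$ with $\hat A_{ij}\neq-\infty$, moves to $i$ and receives $\hat A_{ij}$ from Max; if no such $i$ exists, Min pays an infinite amount to Max and the game terminates. In state $i\in[m]$, Max chooses $j\in[n+1]$ with $\hat B_{ij}\neq-\infty$, moves to $j$ and receives $\hat B_{ij}$ from Min; if no such $j$ exists, Max pays an infinite amount to Min and the game terminates. One turn consists of a move of Min followed by a move of Max. The payoff to Max of an infinite trajectory is the limsup, as $N\to\infty$, of the average payment per turn (payments received minus payments made by Max up to turn $N$, divided by $N$); if the game terminates, the payments are counted up to the termination time. Let $v^N_j$ be the value for Max of the game in finite horizon $N$ (that is, with $N$ turns) started from $j\in[n+1]$; the vectors $v^N$ satisfy $v^0=0$ and $v^N=\hat f(v^{N-1})$ (moves that are not available never contribute). Then $\chi(\hat f):=\lim_{N\to\infty}\hat f^N(0)/N=\lim_{N\to\infty}v^N/N$, where $\hat f^N$ is the $N$-th iterate of $\hat f$, and $\chi_{n+1}(\hat f)$ is its $(n+1)$-th coordinate. *)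

theory Defs
  imports Complex_Main "HOL-Library.Extended_Real"
begin

text \<open>
  The set \<open>\<real> \<union> {-\<infinity>}\<close> is rendered as the set of extended reals different from \<open>\<infinity>\<close>.
  The index sets \<open>[m]\<close> and \<open>[n]\<close> are finite types \<open>'m\<close> and \<open>'n\<close>; the index set \<open>[n + 1]\<close> is
  \<open>'n option\<close>, where \<open>None\<close> plays the role of the additional index \<open>n + 1\<close>.
\<close>

definition append_col :: "('m \<Rightarrow> 'n \<Rightarrow> ereal) \<Rightarrow> ('m \<Rightarrow> ereal) \<Rightarrow> 'm \<Rightarrow> 'n option \<Rightarrow> ereal" where
  "append_col A c i j = (case j of None \<Rightarrow> c i | Some k \<Rightarrow> A i k)"

definition tropical_polyhedron ::
  "('m \<Rightarrow> 'n::finite \<Rightarrow> ereal) \<Rightarrow> ('m \<Rightarrow> 'n \<Rightarrow> ereal) \<Rightarrow> ('m \<Rightarrow> ereal) \<Rightarrow> ('m \<Rightarrow> ereal)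
    \<Rightarrow> ('n \<Rightarrow> ereal) set" where
  "tropical_polyhedron A B c d =
    {x. (\<forall>j. x j \<noteq> \<infinity>) \<and>
        (\<forall>i. max (MAX j. A i j + x j) (c i) \<le> max (MAX j. B i j + x j) (d i))}"

text \<open>
  Iterating the dynamic programming operator may produce \<open>\<infinity>\<close>. In the inner maximum an unavailable
  move (\<open>B i k = -\<infinity>\<close>) must not contribute even if \<open>y k = \<infinity>\<close>, whereas \<open>-\<infinity> + \<infinity> = \<infinity>\<close> for type
  \<^typ>\<open>ereal\<close>; hence the case distinction. In the outer addition the convention of \<^typ>\<open>ereal\<close> is
  the intended one: \<open>- A i j + z = \<infinity>\<close> for all \<open>z\<close> if \<open>A i j = -\<infinity>\<close>.
\<close>

definition dp_operator ::
  "('m::finite \<Rightarrow> 'j::finite \<Rightarrow> ereal) \<Rightarrow> ('m \<Rightarrow> 'j \<Rightarrow> ereal) \<Rightarrow> ('j \<Rightarrow> ereal) \<Rightarrow> 'j \<Rightarrow> ereal" where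
  "dp_operator A B y j =
    (MIN i. - A i j + (MAX k. if B i k = -\<infinity> then -\<infinity> else B i k + y k))"

definition mean_iterate ::
  "('m::finite \<Rightarrow> 'j::finite \<Rightarrow> ereal) \<Rightarrow> ('m \<Rightarrow> 'j \<Rightarrow> ereal) \<Rightarrow> 'j \<Rightarrow> nat \<Rightarrow> ereal" where
  "mean_iterate A B j N = (dp_operator A B ^^ N) (\<lambda>_. 0) j / ereal (real N)"

definition chi ::
  "('m::finite \<Rightarrow> 'j::finite \<Rightarrow> ereal) \<Rightarrow> ('m \<Rightarrow> 'j \<Rightarrow> ereal) \<Rightarrow> 'j \<Rightarrow> ereal" where
  "chi A B j = lim (mean_iterate A B j)"

text \<open>
  A history lists the states visited in the previous turns, latest turn first, each turn as a pair
  of the state of Min and the state of Max. Strategies may depend on the history and on the states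
  visited in the current turn. They are total functions: at a state with no available move their
  value is irrelevant, because the game terminates there.
\<close>

type_synonym ('m, 'j) history = "('j \<times> 'm) list"
type_synonym ('m, 'j) min_strategy = "('m, 'j) history \<Rightarrow> 'j \<Rightarrow> 'm"
type_synonym ('m, 'j) max_strategy = "('m, 'j) history \<Rightarrow> 'j \<Rightarrow> 'm \<Rightarrow> 'j"

definition min_strategies :: "('m \<Rightarrow> 'j \<Rightarrow> ereal) \<Rightarrow> ('m, 'j) min_strategy set" where
  "min_strategies A = {\<tau>. \<forall>h j. (\<exists>i. A i j \<noteq> -\<infinity>) \<longrightarrow> A (\<tau> h j) j \<noteq> -\<infinity>}"

definition max_strategies :: "('m \<Rightarrow> 'j \<Rightarrow> ereal) \<Rightarrow> ('m, 'j) max_strategy set" where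
  "max_strategies B = {\<sigma>. \<forall>h j i. (\<exists>k. B i k \<noteq> -\<infinity>) \<longrightarrow> B i (\<sigma> h j i) \<noteq> -\<infinity>}"

text \<open>
  \<open>play \<sigma> \<tau> j\<^sub>0 N\<close> is the history and the current state of Min after \<open>N\<close> turns. It is
  continued arbitrarily after termination; \<open>total_payment\<close> below ignores this continuation.
\<close>

primrec play ::
  "('m, 'j) max_strategy \<Rightarrow> ('m, 'j) min_strategy \<Rightarrow> 'j \<Rightarrow> nat \<Rightarrow> ('m, 'j) history \<times> 'j" where
  "play \<sigma> \<tau> j\<^sub>0 0 = ([], j\<^sub>0)"
| "play \<sigma> \<tau> j\<^sub>0 (Suc N) =
    (let (h, j) = play \<sigma> \<tau> j\<^sub>0 N; i = \<tau> h j in ((j, i) # h, \<sigma> h j i))"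

text \<open>
  The payment to Max in a turn. For legal strategies \<open>A i j = -\<infinity>\<close> means that Min has no
  available move at \<open>j\<close>, and \<open>B i k = -\<infinity>\<close> that Max has none at \<open>i\<close>. Thus a turn
  has an infinite payment exactly if the game terminates in it.
\<close>

definition turn_payment ::
  "('m \<Rightarrow> 'j \<Rightarrow> ereal) \<Rightarrow> ('m \<Rightarrow> 'j \<Rightarrow> ereal) \<Rightarrow> ('m, 'j) max_strategy \<Rightarrow> ('m, 'j) min_strategy
    \<Rightarrow> 'j \<Rightarrow> nat \<Rightarrow> ereal" where
  "turn_payment A B \<sigma> \<tau> j\<^sub>0 N =
    (let (h, j) = play \<sigma> \<tau> j\<^sub>0 N; i = \<tau> h j; k = \<sigma> h j i in
      if A i j = -\<infinity> then \<infinity> else if B i k = -\<infinity> then -\<infinity> else - A i j + B i k)"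

primrec total_payment ::
  "('m \<Rightarrow> 'j \<Rightarrow> ereal) \<Rightarrow> ('m \<Rightarrow> 'j \<Rightarrow> ereal) \<Rightarrow> ('m, 'j) max_strategy \<Rightarrow> ('m, 'j) min_strategy
    \<Rightarrow> 'j \<Rightarrow> nat \<Rightarrow> ereal" where
  "total_payment A B \<sigma> \<tau> j\<^sub>0 0 = 0"
| "total_payment A B \<sigma> \<tau> j\<^sub>0 (Suc N) =
    (if \<bar>total_payment A B \<sigma> \<tau> j\<^sub>0 N\<bar> = \<infinity> then total_payment A B \<sigma> \<tau> j\<^sub>0 N
     else total_payment A B \<sigma> \<tau> j\<^sub>0 N + turn_payment A B \<sigma> \<tau> j\<^sub>0 N)"

definition mean_payoff ::
  "('m \<Rightarrow> 'j \<Rightarrow> ereal) \<Rightarrow> ('m \<Rightarrow> 'j \<Rightarrow> ereal) \<Rightarrow> ('m, 'j) max_strategy \<Rightarrow> ('m, 'j) min_strategy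
    \<Rightarrow> 'j \<Rightarrow> ereal" where
  "mean_payoff A B \<sigma> \<tau> j\<^sub>0 = limsup (\<lambda>N. total_payment A B \<sigma> \<tau> j\<^sub>0 N / ereal (real N))"

definition is_game_value ::
  "('m \<Rightarrow> 'j \<Rightarrow> ereal) \<Rightarrow> ('m \<Rightarrow> 'j \<Rightarrow> ereal) \<Rightarrow> 'j \<Rightarrow> ereal \<Rightarrow> bool" where
  "is_game_value A B j\<^sub>0 v \<longleftrightarrow>
    (SUP \<sigma>\<in>max_strategies B. INF \<tau>\<in>min_strategies A. mean_payoff A B \<sigma> \<tau> j\<^sub>0) = v \<and>
    (INF \<tau>\<in>min_strategies A. SUP \<sigma>\<in>max_strategies B. mean_payoff A B \<sigma> \<tau> j\<^sub>0) = v"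

end

theory Submission
  imports Defs
begin

text \<open>
  Write \<open>f\<close> for the dynamic programming operator. The heart of the proof is Kohlberg's invariant
  half-line: there are real vectors \<open>g\<close>, \<open>h\<close> with \<open>f(h + t g) = h + (t + 1) g\<close> for all large \<open>t\<close>,
  realised by moves that do not depend on \<open>t\<close>. Coordinates of infinite value are marked by \<open>g = \<plusminus> M\<close>
  for a large constant \<open>M\<close>; there only one of the two inequalities holds. Everything else is read off
  from the half-line.

  To get the half-line, discount the game by a factor \<open>\<alpha> < 1\<close> and replace the infinite terminal
  payments by \<open>\<plusminus> M / (1 - \<alpha>)\<close>, where \<open>M\<close> exceeds the modulus of every finite payment. The discounted
  operator has a fixed point by monotonicity, attained by positional policies
  (\<open>discounted_optimal_policies\<close>). There are finitely many pairs of policies, so one pair is optimal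
  for \<open>\<alpha>\<close> arbitrarily close to \<open>1\<close>. For a fixed pair the play runs into a cycle, and the value expands
  as \<open>g / (1 - \<alpha>) + h + o(1)\<close> (\<open>discounted_sum_expansion\<close>). Put \<open>t + 1 = 1 / (1 - \<alpha>)\<close>: then
  \<open>\<alpha> v = h + t g + o(1)\<close>, so the optimality inequalities become inequalities between affine functions
  of \<open>t\<close>, up to \<open>o(1)\<close>, at arbitrarily large \<open>t\<close>. Such inequalities hold exactly for all large \<open>t\<close>
  (\<open>certificates_exist\<close>).

  A player who follows the half-line policy can telescope the potential \<open>h + t g\<close> along any play, with
  \<open>t\<close> decreasing by one per turn. This bounds the payment after \<open>N\<close> turns by \<open>N g\<close> up to a
  constant, from below for Max and from above for Min; induction on \<open>N\<close> gives the same bounds for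
  \<open>f\<^sup>N(0)\<close>. If \<open>g = M\<close>, the lower bound outgrows every finite total payment, so the total must be
  \<open>\<infinity>\<close> eventually; likewise for \<open>g = - M\<close>. Hence \<open>\<chi>\<close> exists, equals \<open>g\<close> (with \<open>\<plusminus> M\<close> read as
  \<open>\<plusminus>\<infinity>\<close>), and is the value of the game.

  By residuation, and after adding a constant to make the last coordinate zero, the polyhedron is
  nonempty iff there is \<open>y < \<infinity>\<close> with \<open>y \<le> f(y)\<close> that is finite at the last coordinate. Such a \<open>y\<close>
  forces \<open>f\<^sup>N(0) \<ge> y - C\<close> and hence \<open>\<chi> \<ge> 0\<close> there. Conversely, take \<open>y = h + t g\<close> where \<open>g \<ge> 0\<close> and
  \<open>y = -\<infinity>\<close> elsewhere.
\<close>

section \<open>Discounted games\<close>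

text \<open>
  Knaster and Tarski's theorem for a real box: the pointwise supremum of the subsolutions below
  \<open>hi\<close> is a fixed point.
\<close>

lemma mono_real_fixed_point:
  fixes T :: "('j \<Rightarrow> real) \<Rightarrow> 'j \<Rightarrow> real"
  assumes "mono T" and "lo \<le> T lo" and "lo \<le> hi" and "T hi \<le> hi"
  shows "\<exists>v. T v = v"
proof -
  define S where "S = {u. u \<le> T u \<and> u \<le> hi}"
  define v where "v j = (SUP u\<in>S. u j)" for j
  have lo: "lo \<in> S" using assms by (simp add: S_def)
  have bdd: "bdd_above ((\<lambda>u. u j) ` S)" for j
    by (rule bdd_aboveI[of _ "hi j"]) (auto simp: S_def le_fun_def)
  have upper: "u \<le> v" if "u \<in> S" for u
    unfolding le_fun_def v_def using that bdd by (auto intro: cSUP_upper)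
  have least: "v \<le> w" if "\<And>u. u \<in> S \<Longrightarrow> u \<le> w" for w
    unfolding le_fun_def v_def using lo that by (force intro: cSUP_least simp: le_fun_def)
  have vT: "v \<le> T v"
  proof (rule least)
    fix u assume "u \<in> S"
    then have "u \<le> T u" "T u \<le> T v"
      using upper monoD[OF assms(1)] by (auto simp: S_def)
    then show "u \<le> T v" by (rule order_trans)
  qed
  have "v \<le> hi" by (rule least) (auto simp: S_def)
  then have "T v \<in> S"
    using vT monoD[OF assms(1)] assms(4) unfolding S_def by (auto intro: order_trans)
  then show ?thesis using upper vT by (auto intro: antisym)
qed

text \<open>
  The payment of a turn without termination; meaningful only if both entries are finite, but
  bounded over all arguments because \<open>real_of_ereal\<close> sends infinite entries to \<open>0\<close>.
\<close>

definition payment :: "('m \<Rightarrow> 'j \<Rightarrow> ereal) \<Rightarrow> ('m \<Rightarrow> 'j \<Rightarrow> ereal) \<Rightarrow> 'j \<Rightarrow> 'm \<Rightarrow> 'j \<Rightarrow> real" where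
  "payment A B j i k = real_of_ereal (B i k) - real_of_ereal (A i j)"

abbreviation min_moves :: "('m \<Rightarrow> 'j \<Rightarrow> ereal) \<Rightarrow> 'j \<Rightarrow> 'm set" where
  "min_moves A j \<equiv> {i. A i j \<noteq> -\<infinity>}"

abbreviation max_moves :: "('m \<Rightarrow> 'j \<Rightarrow> ereal) \<Rightarrow> 'm \<Rightarrow> 'j set" where
  "max_moves B i \<equiv> {k. B i k \<noteq> -\<infinity>}"

text \<open>
  The deterministic system that remains when both players follow positional policies. A player
  without a move stays at \<open>j\<close> forever at payment \<open>M\<close> or \<open>- M\<close> per turn: this loop has the discounted
  value \<open>\<plusminus> M / (1 - \<alpha>)\<close>, the finite stand-in for the infinite terminal payment.
\<close>

definition policy_succ ::
  "('m \<Rightarrow> 'j \<Rightarrow> ereal) \<Rightarrow> ('m \<Rightarrow> 'j \<Rightarrow> ereal) \<Rightarrow> ('j \<Rightarrow> 'm) \<Rightarrow> ('j \<Rightarrow> 'm \<Rightarrow> 'j) \<Rightarrow> 'j \<Rightarrow> 'j" where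
  "policy_succ A B \<tau> \<sigma> j =
    (if min_moves A j = {} \<or> max_moves B (\<tau> j) = {} then j else \<sigma> j (\<tau> j))"

definition policy_payment ::
  "('m \<Rightarrow> 'j \<Rightarrow> ereal) \<Rightarrow> ('m \<Rightarrow> 'j \<Rightarrow> ereal) \<Rightarrow> real \<Rightarrow> ('j \<Rightarrow> 'm) \<Rightarrow> ('j \<Rightarrow> 'm \<Rightarrow> 'j) \<Rightarrow> 'j \<Rightarrow> real"
  where
  "policy_payment A B M \<tau> \<sigma> j =
    (if min_moves A j = {} then M else if max_moves B (\<tau> j) = {} then - M
     else payment A B j (\<tau> j) (\<sigma> j (\<tau> j)))"

text \<open>
  The equation \<open>v = T\<^sub>\<alpha> v\<close> for the truncated discounted operator, split into what the limit
  \<open>\<alpha> \<longlongrightarrow> 1\<close> uses: the linear system of one fixed pair of policies, and one family of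
  inequalities per player.
\<close>

definition discounted_optimal ::
  "('m \<Rightarrow> 'j \<Rightarrow> ereal) \<Rightarrow> ('m \<Rightarrow> 'j \<Rightarrow> ereal) \<Rightarrow> real \<Rightarrow> real \<Rightarrow> ('j \<Rightarrow> real) \<Rightarrow>
    ('j \<Rightarrow> 'm) \<Rightarrow> ('j \<Rightarrow> 'm \<Rightarrow> 'j) \<Rightarrow> bool" where
  "discounted_optimal A B M \<alpha> v \<tau> \<sigma> \<longleftrightarrow>
    (\<forall>j. v j = policy_payment A B M \<tau> \<sigma> j + \<alpha> * v (policy_succ A B \<tau> \<sigma> j)) \<and>
    (\<forall>j. \<forall>i\<in>min_moves A j. if max_moves B i = {} then v j \<le> - M / (1 - \<alpha>)
      else \<sigma> j i \<in> max_moves B i \<and> v j \<le> payment A B j i (\<sigma> j i) + \<alpha> * v (\<sigma> j i)) \<and>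
    (\<forall>j. if min_moves A j = {} then M / (1 - \<alpha>) \<le> v j
      else \<tau> j \<in> min_moves A j \<and>
        (\<forall>k\<in>max_moves B (\<tau> j). payment A B j (\<tau> j) k + \<alpha> * v k \<le> v j))"

text \<open>
  The truncated operator is monotone and maps the box between the constants \<open>\<plusminus> M / (1 - \<alpha>)\<close> into
  itself, so it has a fixed point; the policies pick a minimal \<open>i\<close> and a maximal \<open>k\<close>.
\<close>

lemma discounted_optimal_policies:
  fixes A B :: "'m::finite \<Rightarrow> 'j::finite \<Rightarrow> ereal"
  assumes \<alpha>: "0 < \<alpha>" "\<alpha> < 1" and K: "\<And>j i k. \<bar>payment A B j i k\<bar> \<le> M"
  shows "\<exists>v \<tau> \<sigma>. discounted_optimal A B M \<alpha> v \<tau> \<sigma>"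
proof -
  define Q where "Q v j i = (if max_moves B i = {} then - M / (1 - \<alpha>)
    else MAX k\<in>max_moves B i. payment A B j i k + \<alpha> * v k)" for v j i
  define T where "T v j = (if min_moves A j = {} then M / (1 - \<alpha>)
    else MIN i\<in>min_moves A j. Q v j i)" for v j
  have M: "0 \<le> M" using K[of undefined undefined undefined] by linarith
  have Q_in: "\<exists>k\<in>max_moves B i. Q v j i = payment A B j i k + \<alpha> * v k"
    if "max_moves B i \<noteq> {}" for v j i
  proof -
    have "Q v j i \<in> (\<lambda>k. payment A B j i k + \<alpha> * v k) ` max_moves B i"
      using that unfolding Q_def by (simp only: if_False) (rule Max_in, auto)
    then show ?thesis by auto
  qed
  have Q_ge: "payment A B j i k + \<alpha> * v k \<le> Q v j i" if "k \<in> max_moves B i" for v j i k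
  proof -
    have "max_moves B i \<noteq> {}" using that by blast
    then show ?thesis using that unfolding Q_def by (simp only: if_False) (rule Max_ge, auto)
  qed
  have T_in: "\<exists>i\<in>min_moves A j. T v j = Q v j i" if "min_moves A j \<noteq> {}" for v j
  proof -
    have "T v j \<in> Q v j ` min_moves A j"
      using that unfolding T_def by (simp only: if_False) (rule Min_in, auto)
    then show ?thesis by auto
  qed
  have T_le: "T v j \<le> Q v j i" if "i \<in> min_moves A j" for v j i
  proof -
    have "min_moves A j \<noteq> {}" using that by blast
    then show ?thesis using that unfolding T_def by (simp only: if_False) (rule Min_le, auto)
  qed
  have Q_mono: "Q u j i \<le> Q v j i" if "u \<le> v" for u v j i
  proof (cases "max_moves B i = {}")
    case False
    then obtain k where k: "k \<in> max_moves B i" "Q u j i = payment A B j i k + \<alpha> * u k"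
      using Q_in by blast
    have "\<alpha> * u k \<le> \<alpha> * v k" using that \<alpha> by (simp add: le_fun_def)
    then show ?thesis using k Q_ge[OF k(1), of j v] by linarith
  qed (simp add: Q_def)
  have "mono T"
  proof (rule monoI, rule le_funI)
    fix u v :: "'j \<Rightarrow> real" and j assume uv: "u \<le> v"
    show "T u j \<le> T v j"
    proof (cases "min_moves A j = {}")
      case False
      then obtain i where i: "i \<in> min_moves A j" "T v j = Q v j i" using T_in by blast
      then show ?thesis using T_le[OF i(1), of u] Q_mono[OF uv, of j i] by linarith
    qed (simp add: T_def)
  qed
  have geometric: "M + \<alpha> * (M / (1 - \<alpha>)) = M / (1 - \<alpha>)"
    using \<alpha> by (simp add: field_simps)
  have bounds: "- M / (1 - \<alpha>) \<le> M / (1 - \<alpha>)"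
    using \<alpha> M by (intro divide_right_mono) auto
  have T_lo: "(\<lambda>_. - M / (1 - \<alpha>)) \<le> T (\<lambda>_. - M / (1 - \<alpha>))"
  proof (rule le_funI)
    fix j
    have "- M / (1 - \<alpha>) \<le> Q (\<lambda>_. - M / (1 - \<alpha>)) j i" for i
    proof (cases "max_moves B i = {}")
      case False
      then obtain k where "Q (\<lambda>_. - M / (1 - \<alpha>)) j i = payment A B j i k + \<alpha> * (- M / (1 - \<alpha>))"
        using Q_in by blast
      moreover have "- M \<le> payment A B j i k" using K[of j i k] by linarith
      ultimately show ?thesis using geometric by simp
    qed (simp add: Q_def)
    then show "- M / (1 - \<alpha>) \<le> T (\<lambda>_. - M / (1 - \<alpha>)) j"
      using T_in[of j "\<lambda>_. - M / (1 - \<alpha>)"] bounds by (cases "min_moves A j = {}") (auto simp: T_def)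
  qed
  have T_hi: "T (\<lambda>_. M / (1 - \<alpha>)) \<le> (\<lambda>_. M / (1 - \<alpha>))"
  proof (rule le_funI)
    fix j
    have "Q (\<lambda>_. M / (1 - \<alpha>)) j i \<le> M / (1 - \<alpha>)" for i
    proof (cases "max_moves B i = {}")
      case False
      then obtain k where "Q (\<lambda>_. M / (1 - \<alpha>)) j i = payment A B j i k + \<alpha> * (M / (1 - \<alpha>))"
        using Q_in by blast
      moreover have "payment A B j i k \<le> M" using K[of j i k] by linarith
      ultimately show ?thesis using geometric by simp
    qed (use bounds in \<open>simp add: Q_def\<close>)
    then show "T (\<lambda>_. M / (1 - \<alpha>)) j \<le> M / (1 - \<alpha>)"
    proof (cases "min_moves A j = {}")
      case False
      then obtain i where "T (\<lambda>_. M / (1 - \<alpha>)) j = Q (\<lambda>_. M / (1 - \<alpha>)) j i"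
        using T_in by blast
      then show ?thesis using \<open>\<And>i. Q (\<lambda>_. M / (1 - \<alpha>)) j i \<le> M / (1 - \<alpha>)\<close> by simp
    qed (simp add: T_def)
  qed
  obtain v where v: "T v = v"
    using mono_real_fixed_point[OF \<open>mono T\<close> T_lo _ T_hi] bounds by (auto simp: le_fun_def)
  define \<sigma> where "\<sigma> j i = (SOME k. k \<in> max_moves B i \<and> Q v j i = payment A B j i k + \<alpha> * v k)" for j i
  have \<sigma>: "\<sigma> j i \<in> max_moves B i \<and> Q v j i = payment A B j i (\<sigma> j i) + \<alpha> * v (\<sigma> j i)"
    if "max_moves B i \<noteq> {}" for j i
    unfolding \<sigma>_def using Q_in[OF that, of v j] unfolding Bex_def by (rule someI_ex)
  define \<tau> where "\<tau> j = (SOME i. i \<in> min_moves A j \<and> T v j = Q v j i)" for j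
  have \<tau>: "\<tau> j \<in> min_moves A j \<and> v j = Q v j (\<tau> j)" if "min_moves A j \<noteq> {}" for j
  proof -
    have "\<tau> j \<in> min_moves A j \<and> T v j = Q v j (\<tau> j)"
      unfolding \<tau>_def using T_in[OF that, of v] unfolding Bex_def by (rule someI_ex)
    then show ?thesis unfolding v .
  qed
  (* A player without a move: M + \<alpha> * (M / (1 - \<alpha>)) = M / (1 - \<alpha>) turns the terminal payment
     into the equation of a loop at j. *)
  have "v j = policy_payment A B M \<tau> \<sigma> j + \<alpha> * v (policy_succ A B \<tau> \<sigma> j)" for j
  proof -
    consider "min_moves A j = {}" | "min_moves A j \<noteq> {}" "max_moves B (\<tau> j) = {}"
      | "min_moves A j \<noteq> {}" "max_moves B (\<tau> j) \<noteq> {}" by blast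
    then show ?thesis
    proof cases
      case 1
      then have "v j = M / (1 - \<alpha>)" using fun_cong[OF v, of j] by (simp add: T_def)
      then show ?thesis using 1 geometric by (simp add: policy_payment_def policy_succ_def)
    next
      case 2
      then have "v j = - M / (1 - \<alpha>)" using \<tau>[OF 2(1)] by (simp add: Q_def)
      moreover have "policy_payment A B M \<tau> \<sigma> j = - M" "policy_succ A B \<tau> \<sigma> j = j"
        using 2 unfolding policy_payment_def policy_succ_def by (simp_all only: if_True if_False simp_thms)
      ultimately show ?thesis using geometric by simp
    next
      case 3
      have "policy_payment A B M \<tau> \<sigma> j = payment A B j (\<tau> j) (\<sigma> j (\<tau> j))"
        "policy_succ A B \<tau> \<sigma> j = \<sigma> j (\<tau> j)"
        using 3 unfolding policy_payment_def policy_succ_def by (simp_all only: if_False simp_thms)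
      then show ?thesis using \<tau>[OF 3(1)] \<sigma>[OF 3(2), of j] by metis
    qed
  qed
  moreover have "if max_moves B i = {} then v j \<le> - M / (1 - \<alpha>)
      else \<sigma> j i \<in> max_moves B i \<and> v j \<le> payment A B j i (\<sigma> j i) + \<alpha> * v (\<sigma> j i)"
    if "i \<in> min_moves A j" for j i
  proof (cases "max_moves B i = {}")
    case True
    then show ?thesis using T_le[OF that, of v] unfolding v by (simp add: Q_def)
  next
    case False
    then show ?thesis using T_le[OF that, of v] \<sigma>[OF False, of j] unfolding v by auto
  qed
  moreover have "if min_moves A j = {} then M / (1 - \<alpha>) \<le> v j
      else \<tau> j \<in> min_moves A j \<and>
        (\<forall>k\<in>max_moves B (\<tau> j). payment A B j (\<tau> j) k + \<alpha> * v k \<le> v j)" for j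
  proof (cases "min_moves A j = {}")
    case True
    then show ?thesis using fun_cong[OF v, of j] by (simp add: T_def)
  next
    case False
    then have "\<forall>k\<in>max_moves B (\<tau> j). payment A B j (\<tau> j) k + \<alpha> * v k \<le> v j"
      using \<tau>[OF False] Q_ge[of _ "\<tau> j" j v] by metis
    then show ?thesis using \<tau>[OF False] False by (simp only: if_False simp_thms)
  qed
  ultimately show ?thesis unfolding discounted_optimal_def by blast
qed

text \<open>
  The orbits of a map on a finite set share a preperiod \<open>p\<close> and a period \<open>L\<close>. Hence \<open>(1 - \<alpha>) v\<close> is a
  polynomial in \<open>\<alpha>\<close> plus a polynomial divided by \<open>1 + \<alpha> + \<dots> + \<alpha>\<^bsup>L - 1\<^esup>\<close>. This function \<open>\<phi>\<close> is
  differentiable at \<open>1\<close>, and its expansion of first order there is the claim, with \<open>g = \<phi>(1)\<close> and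
  \<open>h = - \<phi>'(1)\<close>.
\<close>

lemma discounted_sum_expansion:
  fixes succ :: "'j::finite \<Rightarrow> 'j" and \<rho> :: "'j \<Rightarrow> real"
  shows "\<exists>g h \<delta>. (\<forall>j. (\<delta> j \<longlongrightarrow> (0::real)) (at_left 1)) \<and>
    (\<forall>\<alpha> v. 0 < \<alpha> \<longrightarrow> \<alpha> < 1 \<longrightarrow> (\<forall>j. v j = \<rho> j + \<alpha> * v (succ j)) \<longrightarrow>
      (\<forall>j. v j = g j / (1 - \<alpha>) + h j + \<delta> j \<alpha>))"
proof -
  have "\<not> inj (\<lambda>n::nat. succ ^^ n)"
    using finite_imageD[of "\<lambda>n::nat. succ ^^ n" UNIV] by auto
  then obtain p q where "p < q" and pq: "succ ^^ p = succ ^^ q"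
    unfolding inj_def by (metis linorder_neqE_nat)
  define L where "L = q - p"
  have L: "L > 0" "q = L + p" using \<open>p < q\<close> by (auto simp: L_def)
  define \<phi> where "\<phi> j \<alpha> = (1 - \<alpha>) * (\<Sum>s<p. \<alpha> ^ s * \<rho> ((succ ^^ s) j)) +
    \<alpha> ^ p * ((\<Sum>s<L. \<alpha> ^ s * \<rho> ((succ ^^ s) ((succ ^^ p) j))) / (\<Sum>s<L. \<alpha> ^ s))" for j and \<alpha> :: real
  have "\<phi> j differentiable (at 1)" for j
    unfolding \<phi>_def using L by (auto intro!: derivative_intros)
  then obtain D where D: "\<And>j. (\<phi> j has_real_derivative D j) (at 1)"
    unfolding real_differentiable_def by metis
  define \<delta> where "\<delta> j \<alpha> = \<phi> j \<alpha> / (1 - \<alpha>) - \<phi> j 1 / (1 - \<alpha>) + D j" for j \<alpha>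
  have "(\<delta> j \<longlongrightarrow> 0) (at_left 1)" for j
  proof -
    have "((\<lambda>\<alpha>. D j - (\<phi> j \<alpha> - \<phi> j 1) / (\<alpha> - 1)) \<longlongrightarrow> D j - D j) (at 1)"
      using D[of j] unfolding has_field_derivative_iff by (intro tendsto_intros)
    moreover have "D j - (\<phi> j \<alpha> - \<phi> j 1) / (\<alpha> - 1) = \<delta> j \<alpha>" for \<alpha>
    proof -
      have "(\<phi> j \<alpha> - \<phi> j 1) / (\<alpha> - 1) = - ((\<phi> j \<alpha> - \<phi> j 1) / (1 - \<alpha>))"
        by (metis minus_diff_eq minus_divide_right)
      then show ?thesis unfolding \<delta>_def by (simp add: diff_divide_distrib)
    qed
    ultimately show ?thesis
      by (simp add: filterlim_at_split)
  qed
  moreover have "v j = \<phi> j 1 / (1 - \<alpha>) + (- D j) + \<delta> j \<alpha>"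
    if \<alpha>: "0 < \<alpha>" "\<alpha> < 1" and v: "\<And>j. v j = \<rho> j + \<alpha> * v (succ j)" for \<alpha> v j
  proof -
    have unroll: "v j = (\<Sum>s<N. \<alpha> ^ s * \<rho> ((succ ^^ s) j)) + \<alpha> ^ N * v ((succ ^^ N) j)" for N j
    proof (induction N)
      case (Suc N)
      then show ?case using v[of "(succ ^^ N) j"] by (simp add: algebra_simps)
    qed simp
    define x where "x = (succ ^^ p) j"
    have x: "(succ ^^ L) x = x"
      unfolding x_def using pq L(2) by (metis comp_apply funpow_add)
    define G where "G = (\<Sum>s<L. \<alpha> ^ s)"
    have "0 < G" unfolding G_def using \<alpha> L by (intro sum_pos) auto
    have G: "1 - \<alpha> ^ L = (1 - \<alpha>) * G"
      unfolding G_def by (rule one_diff_power_eq)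
    have "(1 - \<alpha> ^ L) * v x = (\<Sum>s<L. \<alpha> ^ s * \<rho> ((succ ^^ s) x))"
      using unroll[of x L] unfolding x by (simp add: algebra_simps)
    then have "(1 - \<alpha>) * v x = (\<Sum>s<L. \<alpha> ^ s * \<rho> ((succ ^^ s) x)) / G"
      using \<open>0 < G\<close> unfolding G by (simp add: field_simps)
    then have "\<phi> j \<alpha> = (1 - \<alpha>) * (\<Sum>s<p. \<alpha> ^ s * \<rho> ((succ ^^ s) j)) + \<alpha> ^ p * ((1 - \<alpha>) * v x)"
      unfolding \<phi>_def x_def[symmetric] G_def[symmetric] by simp
    then have "\<phi> j \<alpha> = (1 - \<alpha>) * ((\<Sum>s<p. \<alpha> ^ s * \<rho> ((succ ^^ s) j)) + \<alpha> ^ p * v x)"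
      by (simp add: algebra_simps)
    then have "(1 - \<alpha>) * v j = \<phi> j \<alpha>"
      using unroll[of j p] unfolding x_def by simp
    then have "v j = \<phi> j \<alpha> / (1 - \<alpha>)" using \<alpha> by (simp add: field_simps)
    then show ?thesis unfolding \<delta>_def by simp
  qed
  ultimately show ?thesis
    by (intro exI[of _ "\<lambda>j. \<phi> j 1"] exI[of _ "\<lambda>j. - D j"] exI[of _ \<delta>]) blast
qed

section \<open>Letting the discount factor tend to one\<close>

text \<open>
  In terms of \<open>t = 1 / (1 - \<alpha>) - 1\<close>, an affine function that is nonnegative up to \<open>o(1)\<close> at arbitrarily
  large \<open>t\<close> has a positive slope, or slope zero and a nonnegative constant.
\<close>

lemma eventually_affine_nonneg:
  fixes a b :: real
  assumes \<delta>: "(\<delta> \<longlongrightarrow> 0) (at_left (1::real))"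
    and freq: "\<exists>\<^sub>F \<alpha> in at_left 1. 0 \<le> a + b / (1 - \<alpha>) + \<delta> \<alpha>"
  shows "0 \<le> b" and "\<forall>\<^sub>F t in at_top. 0 \<le> a + b * (t + 1)"
proof -
  have "filterlim (\<lambda>\<alpha>::real. 1 - \<alpha>) (at_right 0) (at_left 1)"
    by (auto simp: filterlim_at eventually_at_filter intro!: tendsto_eq_intros)
  then have inv: "filterlim (\<lambda>\<alpha>::real. inverse (1 - \<alpha>)) at_top (at_left 1)"
    by (rule filterlim_compose[OF filterlim_inverse_at_top_right])
  have a\<delta>: "((\<lambda>\<alpha>. a + \<delta> \<alpha>) \<longlongrightarrow> a) (at_left 1)"
    using tendsto_add[OF tendsto_const \<delta>, of a] by simp
  show b: "0 \<le> b"
  proof (rule ccontr)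
    assume "\<not> 0 \<le> b"
    then have "filterlim (\<lambda>\<alpha>. (- b) * inverse (1 - \<alpha>)) at_top (at_left 1)"
      by (intro filterlim_tendsto_pos_mult_at_top[OF tendsto_const _ inv]) auto
    then have "\<forall>\<^sub>F \<alpha> in at_left 1. a + 1 \<le> (- b) * inverse (1 - \<alpha>)"
      by (auto simp: filterlim_at_top)
    moreover have "\<forall>\<^sub>F \<alpha> in at_left 1. a + \<delta> \<alpha> < a + 1"
      using order_tendstoD(2)[OF a\<delta>, of "a + 1"] by simp
    ultimately have "\<forall>\<^sub>F \<alpha> in at_left 1. \<not> 0 \<le> a + b / (1 - \<alpha>) + \<delta> \<alpha>"
      by eventually_elim (simp add: divide_inverse)
    then show False using freq by (simp add: frequently_def)
  qed
  show "\<forall>\<^sub>F t in at_top. 0 \<le> a + b * (t + 1)"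
  proof (cases "b = 0")
    case True
    have "0 \<le> a"
    proof (rule ccontr)
      assume "\<not> 0 \<le> a"
      then have "\<forall>\<^sub>F \<alpha> in at_left 1. a + \<delta> \<alpha> < 0" using order_tendstoD(2)[OF a\<delta>] by simp
      then show False using freq True by (simp add: frequently_def not_le)
    qed
    then show ?thesis using True by simp
  next
    case False
    then have "0 < b" using b by simp
    show ?thesis
      using eventually_ge_at_top[of "- a / b - 1"]
      by eventually_elim (use \<open>0 < b\<close> in \<open>simp add: field_simps\<close>)
  qed
qed

text \<open>
  With \<open>\<Phi>\<^sub>t = h + t g\<close>, the two certificates say that \<open>\<Phi>\<^sub>t\<^sub>+\<^sub>1 = f(\<Phi>\<^sub>t)\<close> for all large \<open>t\<close>, where
  \<open>f\<close> is the dynamic programming operator: an invariant half-line. Max's half gives \<open>\<le>\<close> where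
  \<open>g > - M\<close>, Min's half gives \<open>\<ge>\<close> where \<open>g < M\<close>, and each half is realised by a move that does not
  depend on \<open>t\<close>. Since \<open>g\<close> moves in the mover's favour, the region in which a certificate applies
  is never left. Thus \<open>g = M\<close> and \<open>g = - M\<close> stand for the values \<open>\<plusminus>\<infinity>\<close>.
\<close>

definition max_certificate ::
  "('m \<Rightarrow> 'j \<Rightarrow> ereal) \<Rightarrow> ('m \<Rightarrow> 'j \<Rightarrow> ereal) \<Rightarrow> real \<Rightarrow> ('j \<Rightarrow> real) \<Rightarrow> ('j \<Rightarrow> real) \<Rightarrow> real \<Rightarrow>
    ('j \<Rightarrow> 'm \<Rightarrow> 'j) \<Rightarrow> bool" where
  "max_certificate A B M g h t\<^sub>0 \<sigma> \<longleftrightarrow>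
    (\<forall>j i. - M < g j \<longrightarrow> A i j \<noteq> -\<infinity> \<longrightarrow> B i (\<sigma> j i) \<noteq> -\<infinity> \<and> g j \<le> g (\<sigma> j i) \<and>
      (\<forall>t\<ge>t\<^sub>0. h j + (t + 1) * g j \<le> payment A B j i (\<sigma> j i) + (h (\<sigma> j i) + t * g (\<sigma> j i))))"

definition min_certificate ::
  "('m \<Rightarrow> 'j \<Rightarrow> ereal) \<Rightarrow> ('m \<Rightarrow> 'j \<Rightarrow> ereal) \<Rightarrow> real \<Rightarrow> ('j \<Rightarrow> real) \<Rightarrow> ('j \<Rightarrow> real) \<Rightarrow> real \<Rightarrow>
    ('j \<Rightarrow> 'm) \<Rightarrow> bool" where
  "min_certificate A B M g h t\<^sub>0 \<tau> \<longleftrightarrow>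
    (\<forall>j. g j < M \<longrightarrow> A (\<tau> j) j \<noteq> -\<infinity> \<and> (\<forall>k. B (\<tau> j) k \<noteq> -\<infinity> \<longrightarrow> g k \<le> g j \<and>
      (\<forall>t\<ge>t\<^sub>0. payment A B j (\<tau> j) k + (h k + t * g k) \<le> h j + (t + 1) * g j)))"

text \<open>
  The pair \<open>(\<tau>, \<sigma>)\<close> is found by the pigeonhole principle. Each of its optimality inequalities then holds
  for \<open>\<alpha>\<close> arbitrarily close to \<open>1\<close>, with one expansion of \<open>v\<close> for all these \<open>\<alpha>\<close>. Where a player has no
  move, the same argument compares \<open>g\<close> with \<open>\<plusminus> M\<close>.
\<close>

theorem certificates_exist:
  fixes A B :: "'m::finite \<Rightarrow> 'j::finite \<Rightarrow> ereal"
  assumes K: "\<And>j i k. \<bar>payment A B j i k\<bar> \<le> M"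
  shows "\<exists>g h t\<^sub>0 \<sigma> \<tau>. max_certificate A B M g h t\<^sub>0 \<sigma> \<and> min_certificate A B M g h t\<^sub>0 \<tau>"
proof -
  let ?optimal = "discounted_optimal A B M"
  have near: "\<forall>\<^sub>F \<alpha> in at_left (1::real). 0 < \<alpha> \<and> \<alpha> < 1"
    using eventually_at_left_real[of 0 1] by simp
  have "\<forall>\<^sub>F \<alpha> in at_left (1::real). \<exists>x\<in>UNIV. 0 < \<alpha> \<and> \<alpha> < 1 \<and> (\<exists>v. ?optimal \<alpha> v (fst x) (snd x))"
    using near
  proof eventually_elim
    case (elim \<alpha>)
    then obtain v \<tau> \<sigma> where "?optimal \<alpha> v \<tau> \<sigma>"
      using discounted_optimal_policies[OF _ _ K, of \<alpha>] by blast
    then show ?case using elim by (intro bexI[of _ "(\<tau>, \<sigma>)"]) auto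
  qed
  then have "\<exists>\<^sub>F \<alpha> in at_left (1::real). \<exists>x\<in>UNIV. 0 < \<alpha> \<and> \<alpha> < 1 \<and> (\<exists>v. ?optimal \<alpha> v (fst x) (snd x))"
    by (rule eventually_frequently[rotated]) simp
  then obtain \<tau> \<sigma> where freq: "\<exists>\<^sub>F \<alpha> in at_left (1::real). 0 < \<alpha> \<and> \<alpha> < 1 \<and> (\<exists>v. ?optimal \<alpha> v \<tau> \<sigma>)"
    by (subst (asm) frequently_bex_finite_distrib) auto
  obtain g h \<delta> where \<delta>: "\<And>j. (\<delta> j \<longlongrightarrow> 0) (at_left 1)"
    and exp: "\<And>\<alpha> v j. \<lbrakk>0 < \<alpha>; \<alpha> < 1; ?optimal \<alpha> v \<tau> \<sigma>\<rbrakk> \<Longrightarrow> v j = g j / (1 - \<alpha>) + h j + \<delta> j \<alpha>"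
    using discounted_sum_expansion[of "policy_payment A B M \<tau> \<sigma>" "policy_succ A B \<tau> \<sigma>"]
    unfolding discounted_optimal_def by blast
  have frequentlyI: "\<exists>\<^sub>F \<alpha> in at_left 1. P \<alpha>"
    if "\<And>\<alpha> v. \<lbrakk>0 < \<alpha>; \<alpha> < 1; ?optimal \<alpha> v \<tau> \<sigma>\<rbrakk> \<Longrightarrow> P \<alpha>" for P
    using freq by (rule frequently_elim1) (use that in blast)
  (* \<alpha> * g k / (1 - \<alpha>) = g k / (1 - \<alpha>) - g k, which turns t + 1 into t at the successor k;
     the rest of the difference between \<alpha> * v k and h k + t * g k vanishes in the limit. *)
  define err where "err j k \<alpha> = \<alpha> * \<delta> k \<alpha> - (1 - \<alpha>) * h k - \<delta> j \<alpha>" for j k \<alpha>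
  have err: "(err j k \<longlongrightarrow> 0) (at_left 1)" for j k
    unfolding err_def by (rule tendsto_eq_intros \<delta> refl | simp)+
  have slack: "r + \<alpha> * v k - v j = (r + h k - g k - h j) + (g k - g j) / (1 - \<alpha>) + err j k \<alpha>"
    if "0 < \<alpha>" "\<alpha> < 1" "?optimal \<alpha> v \<tau> \<sigma>" for \<alpha> v r j k
  proof -
    have "\<alpha> * (g k / (1 - \<alpha>)) = g k / (1 - \<alpha>) - g k" using that(2) by (simp add: field_simps)
    then have "\<alpha> * v k = g k / (1 - \<alpha>) - g k + \<alpha> * h k + \<alpha> * \<delta> k \<alpha>"
      unfolding exp[OF that, of k] by (simp add: algebra_simps)
    then show ?thesis
      unfolding err_def exp[OF that, of j] by (simp add: diff_divide_distrib algebra_simps)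
  qed
  have opt_max: "if max_moves B i = {} then v j \<le> - M / (1 - \<alpha>)
      else \<sigma> j i \<in> max_moves B i \<and> v j \<le> payment A B j i (\<sigma> j i) + \<alpha> * v (\<sigma> j i)"
    if "?optimal \<alpha> v \<tau> \<sigma>" "A i j \<noteq> -\<infinity>" for \<alpha> v i j
    using that unfolding discounted_optimal_def by blast
  have opt_min: "if min_moves A j = {} then M / (1 - \<alpha>) \<le> v j
      else \<tau> j \<in> min_moves A j \<and>
        (\<forall>k\<in>max_moves B (\<tau> j). payment A B j (\<tau> j) k + \<alpha> * v k \<le> v j)"
    if "?optimal \<alpha> v \<tau> \<sigma>" for \<alpha> v j
    using that unfolding discounted_optimal_def by blast
  have max_step: "\<sigma> j i \<in> max_moves B i \<and> g j \<le> g (\<sigma> j i) \<and>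
      (\<forall>\<^sub>F t in at_top. h j + (t + 1) * g j \<le> payment A B j i (\<sigma> j i) + (h (\<sigma> j i) + t * g (\<sigma> j i)))"
    if "- M < g j" and i: "A i j \<noteq> -\<infinity>" for j i
  proof (cases "max_moves B i = {}")
    case True
    have "\<exists>\<^sub>F \<alpha> in at_left 1. 0 \<le> - h j + (- M - g j) / (1 - \<alpha>) + (- \<delta> j \<alpha>)"
    proof (rule frequentlyI)
      fix \<alpha> v assume *: "0 < \<alpha>" "\<alpha> < 1" "?optimal \<alpha> v \<tau> \<sigma>"
      then have "v j \<le> - M / (1 - \<alpha>)" using opt_max[OF *(3) i] True by simp
      then show "0 \<le> - h j + (- M - g j) / (1 - \<alpha>) + (- \<delta> j \<alpha>)"
        using exp[OF *, of j] by (simp add: diff_divide_distrib)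
    qed
    moreover have "((\<lambda>\<alpha>. - \<delta> j \<alpha>) \<longlongrightarrow> 0) (at_left 1)" using tendsto_minus[OF \<delta>[of j]] by simp
    ultimately have "0 \<le> - M - g j" by (intro eventually_affine_nonneg(1))
    with that show ?thesis by simp
  next
    case False
    define k where "k = \<sigma> j i"
    define r where "r = payment A B j i k"
    have k: "k \<in> max_moves B i \<and> v j \<le> r + \<alpha> * v k"
      if "?optimal \<alpha> v \<tau> \<sigma>" for \<alpha> v
      using opt_max[OF that i] False unfolding k_def r_def by (simp split: if_splits)
    have "k \<in> max_moves B i"
      using frequently_ex[OF freq] k by blast
    have "\<exists>\<^sub>F \<alpha> in at_left 1. 0 \<le> (r + h k - g k - h j) + (g k - g j) / (1 - \<alpha>) + err j k \<alpha>"
    proof (rule frequentlyI)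
      fix \<alpha> v assume *: "0 < \<alpha>" "\<alpha> < 1" "?optimal \<alpha> v \<tau> \<sigma>"
      have "0 \<le> r + \<alpha> * v k - v j" using k[OF *(3)] by simp
      then show "0 \<le> (r + h k - g k - h j) + (g k - g j) / (1 - \<alpha>) + err j k \<alpha>"
        unfolding slack[OF *] .
    qed
    note affine = eventually_affine_nonneg[OF err this]
    have "\<forall>\<^sub>F t in at_top. h j + (t + 1) * g j \<le> r + (h k + t * g k)"
      using affine(2) by eventually_elim (simp add: algebra_simps)
    then show ?thesis
      using affine(1) \<open>k \<in> max_moves B i\<close> unfolding r_def k_def by simp
  qed
  have min_step: "\<tau> j \<in> min_moves A j \<and> (\<forall>k\<in>max_moves B (\<tau> j). g k \<le> g j \<and>
      (\<forall>\<^sub>F t in at_top. payment A B j (\<tau> j) k + (h k + t * g k) \<le> h j + (t + 1) * g j))"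
    if "g j < M" for j
  proof (cases "min_moves A j = {}")
    case True
    have "\<exists>\<^sub>F \<alpha> in at_left 1. 0 \<le> h j + (g j - M) / (1 - \<alpha>) + \<delta> j \<alpha>"
    proof (rule frequentlyI)
      fix \<alpha> v assume *: "0 < \<alpha>" "\<alpha> < 1" "?optimal \<alpha> v \<tau> \<sigma>"
      then have "M / (1 - \<alpha>) \<le> v j" using opt_min[OF *(3), of j] True by simp
      then show "0 \<le> h j + (g j - M) / (1 - \<alpha>) + \<delta> j \<alpha>"
        using exp[OF *, of j] by (simp add: diff_divide_distrib)
    qed
    then have "0 \<le> g j - M" by (rule eventually_affine_nonneg(1)[OF \<delta>])
    with that show ?thesis by simp
  next
    case False
    have opt: "\<tau> j \<in> min_moves A j \<and>
        (\<forall>k\<in>max_moves B (\<tau> j). payment A B j (\<tau> j) k + \<alpha> * v k \<le> v j)"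
      if "?optimal \<alpha> v \<tau> \<sigma>" for \<alpha> v
      using opt_min[OF that, of j] False by (simp split: if_splits)
    have "g k \<le> g j \<and>
      (\<forall>\<^sub>F t in at_top. payment A B j (\<tau> j) k + (h k + t * g k) \<le> h j + (t + 1) * g j)"
      if k: "k \<in> max_moves B (\<tau> j)" for k
    proof -
      define r where "r = payment A B j (\<tau> j) k"
      have lim: "((\<lambda>\<alpha>. - err j k \<alpha>) \<longlongrightarrow> 0) (at_left 1)"
        using tendsto_minus[OF err[of j k]] by simp
      have "\<exists>\<^sub>F \<alpha> in at_left 1. 0 \<le> - (r + h k - g k - h j) + (g j - g k) / (1 - \<alpha>) + (- err j k \<alpha>)"
      proof (rule frequentlyI)
        fix \<alpha> v assume *: "0 < \<alpha>" "\<alpha> < 1" "?optimal \<alpha> v \<tau> \<sigma>"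
        have "r + \<alpha> * v k - v j \<le> 0" using opt[OF *(3)] k unfolding r_def by auto
        moreover have "(g j - g k) / (1 - \<alpha>) = - ((g k - g j) / (1 - \<alpha>))"
          by (simp add: diff_divide_distrib)
        ultimately show "0 \<le> - (r + h k - g k - h j) + (g j - g k) / (1 - \<alpha>) + (- err j k \<alpha>)"
          unfolding slack[OF *] by linarith
      qed
      note affine = eventually_affine_nonneg[OF lim this]
      have "\<forall>\<^sub>F t in at_top. r + (h k + t * g k) \<le> h j + (t + 1) * g j"
        using affine(2) by eventually_elim (simp add: algebra_simps)
      then show ?thesis using affine(1) unfolding r_def by simp
    qed
    moreover have "\<tau> j \<in> min_moves A j" using frequently_ex[OF freq] opt by blast
    ultimately show ?thesis by blast
  qed
  have "\<forall>\<^sub>F t in at_top. - M < g j \<longrightarrow> A i j \<noteq> -\<infinity> \<longrightarrow>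
      h j + (t + 1) * g j \<le> payment A B j i (\<sigma> j i) + (h (\<sigma> j i) + t * g (\<sigma> j i))" for j i
    using max_step[of j i] by (cases "- M < g j \<and> A i j \<noteq> -\<infinity>") auto
  then have ev1: "\<forall>\<^sub>F t in at_top. \<forall>j i. - M < g j \<longrightarrow> A i j \<noteq> -\<infinity> \<longrightarrow>
      h j + (t + 1) * g j \<le> payment A B j i (\<sigma> j i) + (h (\<sigma> j i) + t * g (\<sigma> j i))"
    by (intro eventually_all_finite)
  have "\<forall>\<^sub>F t in at_top. g j < M \<longrightarrow> B (\<tau> j) k \<noteq> -\<infinity> \<longrightarrow>
      payment A B j (\<tau> j) k + (h k + t * g k) \<le> h j + (t + 1) * g j" for j k
    using min_step[of j] by (cases "g j < M \<and> B (\<tau> j) k \<noteq> -\<infinity>") auto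
  then have ev2: "\<forall>\<^sub>F t in at_top. \<forall>j k. g j < M \<longrightarrow> B (\<tau> j) k \<noteq> -\<infinity> \<longrightarrow>
      payment A B j (\<tau> j) k + (h k + t * g k) \<le> h j + (t + 1) * g j"
    by (intro eventually_all_finite)
  obtain t\<^sub>1 where t\<^sub>1: "\<forall>t\<ge>t\<^sub>1. \<forall>j i. - M < g j \<longrightarrow> A i j \<noteq> -\<infinity> \<longrightarrow>
      h j + (t + 1) * g j \<le> payment A B j i (\<sigma> j i) + (h (\<sigma> j i) + t * g (\<sigma> j i))"
    using ev1 unfolding eventually_at_top_linorder by (rule exE)
  obtain t\<^sub>2 where t\<^sub>2: "\<forall>t\<ge>t\<^sub>2. \<forall>j k. g j < M \<longrightarrow> B (\<tau> j) k \<noteq> -\<infinity> \<longrightarrow>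
      payment A B j (\<tau> j) k + (h k + t * g k) \<le> h j + (t + 1) * g j"
    using ev2 unfolding eventually_at_top_linorder by (rule exE)
  define t\<^sub>0 where "t\<^sub>0 = max t\<^sub>1 t\<^sub>2"
  have "max_certificate A B M g h t\<^sub>0 \<sigma>"
    unfolding max_certificate_def
  proof (intro allI impI conjI)
    fix j i assume *: "- M < g j" "A i j \<noteq> -\<infinity>"
    note step = max_step[OF this]
    show "B i (\<sigma> j i) \<noteq> -\<infinity>" "g j \<le> g (\<sigma> j i)" using step by blast+
    fix t assume "t\<^sub>0 \<le> t"
    then have "t\<^sub>1 \<le> t" by (simp add: t\<^sub>0_def)
    with * show "h j + (t + 1) * g j \<le> payment A B j i (\<sigma> j i) + (h (\<sigma> j i) + t * g (\<sigma> j i))"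
      using t\<^sub>1 by blast
  qed
  moreover have "min_certificate A B M g h t\<^sub>0 \<tau>"
    unfolding min_certificate_def
  proof (intro allI impI conjI)
    fix j assume j: "g j < M"
    note step = min_step[OF this]
    show "A (\<tau> j) j \<noteq> -\<infinity>" using step by blast
    fix k assume k: "B (\<tau> j) k \<noteq> -\<infinity>"
    show "g k \<le> g j" using step k by blast
    fix t assume "t\<^sub>0 \<le> t"
    then have "t\<^sub>2 \<le> t" by (simp add: t\<^sub>0_def)
    with j k show "payment A B j (\<tau> j) k + (h k + t * g k) \<le> h j + (t + 1) * g j"
      using t\<^sub>2 by blast
  qed
  ultimately show ?thesis by blast
qed

section \<open>Averages of sequences with linear growth\<close>

text \<open>Slopes outside the open interval from \<open>- M\<close> to \<open>M\<close> encode infinite values.\<close>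

definition growth_value :: "real \<Rightarrow> real \<Rightarrow> ereal" where
  "growth_value M g = (if M \<le> g then \<infinity> else if g \<le> - M then -\<infinity> else ereal g)"

lemma growth_value_uminus: "0 < M \<Longrightarrow> growth_value M (- g) = - growth_value M g"
  by (auto simp: growth_value_def)

text \<open>
  If \<open>g \<ge> M > K\<close>, the lower bound \<open>N g - C\<close> eventually exceeds \<open>N K\<close>, the largest finite value
  that \<open>X N\<close> may take; so \<open>X N = \<infinity>\<close> from then on.
\<close>

lemma liminf_average_ge:
  assumes M: "0 < M" "K < M"
    and bounded: "\<And>N. \<bar>X N\<bar> = \<infinity> \<or> \<bar>X N\<bar> \<le> ereal (real N * K)"
    and lower: "\<And>N. - M < g \<Longrightarrow> ereal (real N * g - C) \<le> X N"
  shows "growth_value M g \<le> liminf (\<lambda>N. X N / ereal (real N))"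
proof -
  consider "g \<le> - M" | "M \<le> g" | "- M < g" "g < M" by linarith
  then show ?thesis
  proof cases
    case 1
    then show ?thesis using M by (simp add: growth_value_def)
  next
    case 2
    have "\<forall>\<^sub>F N in sequentially. C / (M - K) < real N"
      using filterlim_real_sequentially by (simp add: filterlim_at_top_dense)
    moreover have "\<forall>\<^sub>F N in sequentially. 0 < N" by (rule eventually_gt_at_top)
    ultimately have "\<forall>\<^sub>F N in sequentially. growth_value M g \<le> X N / ereal (real N)"
    proof eventually_elim
      case (elim N)
      then have "C < real N * (M - K)" using M by (simp add: pos_divide_less_eq)
      moreover have "real N * M \<le> real N * g" using 2 by (intro mult_left_mono) auto
      ultimately have "real N * K < real N * g - C" by (simp add: algebra_simps)
      moreover have "ereal (real N * g - C) \<le> X N" using lower 2 M by simp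
      ultimately have "X N = \<infinity>"
        using bounded[of N] by (cases "X N") auto
      then show ?case using elim by simp
    qed
    then show ?thesis by (rule Liminf_bounded)
  next
    case 3
    have "(\<lambda>N. ereal (g - C / real N)) \<longlonglongrightarrow> ereal (g - 0)"
      by (intro tendsto_intros tendsto_divide_0[OF tendsto_const]
          filterlim_at_top_imp_at_infinity filterlim_real_sequentially)
    then have "liminf (\<lambda>N. ereal (g - C / real N)) = ereal g"
      by (simp add: lim_imp_Liminf)
    moreover have "\<forall>\<^sub>F N in sequentially. ereal (g - C / real N) \<le> X N / ereal (real N)"
      using eventually_gt_at_top[of 0]
    proof eventually_elim
      case (elim N)
      then have "ereal (g - C / real N) = ereal (real N * g - C) / ereal (real N)"
        by (simp add: field_simps)
      also have "\<dots> \<le> X N / ereal (real N)"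
        using lower[OF 3(1), of N] elim by (intro ereal_divide_right_mono) auto
      finally show ?case .
    qed
    ultimately have "ereal g \<le> liminf (\<lambda>N. X N / ereal (real N))"
      by (metis Liminf_mono)
    then show ?thesis using 3 by (simp add: growth_value_def)
  qed
qed

lemma limsup_average_le:
  assumes M: "0 < M" "K < M"
    and bounded: "\<And>N. \<bar>X N\<bar> = \<infinity> \<or> \<bar>X N\<bar> \<le> ereal (real N * K)"
    and upper: "\<And>N. g < M \<Longrightarrow> X N \<le> ereal (real N * g + C)"
  shows "limsup (\<lambda>N. X N / ereal (real N)) \<le> growth_value M g"
proof -
  have "growth_value M (- g) \<le> liminf (\<lambda>N. - X N / ereal (real N))"
  proof (rule liminf_average_ge[OF M, where C = C])
    show "ereal (real N * - g - C) \<le> - X N" if "- M < - g" for N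
      using upper[of N] that by (cases "X N") auto
  qed (use bounded in auto)
  moreover have "liminf (\<lambda>N. - X N / ereal (real N)) = - limsup (\<lambda>N. X N / ereal (real N))"
    by (simp add: ereal_Liminf_uminus)
  ultimately show ?thesis using growth_value_uminus[OF M(1)] by simp
qed

section \<open>The dynamic programming operator\<close>

lemma dp_operator_ge:
  fixes A B :: "'m::finite \<Rightarrow> 'j::finite \<Rightarrow> ereal"
  assumes "\<And>i. A i j \<noteq> -\<infinity> \<Longrightarrow> \<exists>k. B i k \<noteq> -\<infinity> \<and> x \<le> - A i j + (B i k + y k)"
  shows "x \<le> dp_operator A B y j"
  unfolding dp_operator_def
proof (rule Min.boundedI)
  fix z assume "z \<in> range (\<lambda>i. - A i j + (MAX k. if B i k = -\<infinity> then -\<infinity> else B i k + y k))"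
  then obtain i where z: "z = - A i j + (MAX k. if B i k = -\<infinity> then -\<infinity> else B i k + y k)"
    by blast
  show "x \<le> z"
  proof (cases "A i j = -\<infinity>")
    case False
    then obtain k where k: "B i k \<noteq> -\<infinity>" "x \<le> - A i j + (B i k + y k)" using assms by blast
    have "B i k + y k = (if B i k = -\<infinity> then -\<infinity> else B i k + y k)" using k by simp
    also have "\<dots> \<le> (MAX k. if B i k = -\<infinity> then -\<infinity> else B i k + y k)" by (rule Max_ge) auto
    finally show ?thesis unfolding z by (intro order_trans[OF k(2)] add_left_mono)
  qed (simp add: z)
qed auto

lemma dp_operator_attained:
  fixes A B :: "'m::finite \<Rightarrow> 'j::finite \<Rightarrow> ereal"
  assumes "\<And>i j. A i j \<noteq> \<infinity>"
  shows "\<exists>i k. dp_operator A B y j =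
    (if A i j = -\<infinity> then \<infinity> else if B i k = -\<infinity> then -\<infinity> else - A i j + (B i k + y k))"
proof -
  let ?v = "\<lambda>i k. if B i k = -\<infinity> then -\<infinity> else B i k + y k"
  have "dp_operator A B y j \<in> range (\<lambda>i. - A i j + (MAX k. ?v i k))"
    unfolding dp_operator_def by (rule Min_in) auto
  then obtain i where i: "dp_operator A B y j = - A i j + (MAX k. ?v i k)" by blast
  have "(MAX k. ?v i k) \<in> range (?v i)" by (rule Max_in) auto
  then obtain k where k: "(MAX k. ?v i k) = ?v i k" by blast
  show ?thesis
    unfolding i k using assms[of i j] by (intro exI[of _ i] exI[of _ k]) (cases "A i j"; simp)
qed

lemma dp_operator_le:
  fixes A B :: "'m::finite \<Rightarrow> 'j::finite \<Rightarrow> ereal"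
  assumes "\<bar>A i j\<bar> \<noteq> \<infinity>" and "\<And>k. B i k \<noteq> -\<infinity> \<Longrightarrow> - A i j + (B i k + y k) \<le> x"
  shows "dp_operator A B y j \<le> x"
proof -
  let ?v = "\<lambda>k. if B i k = -\<infinity> then -\<infinity> else B i k + y k"
  have "(MAX k. ?v k) \<in> range ?v" by (rule Max_in) auto
  then obtain k where k: "(MAX k. ?v k) = ?v k" by blast
  have "dp_operator A B y j \<le> - A i j + (MAX k. ?v k)"
    unfolding dp_operator_def by (rule Min_le) auto
  also have "\<dots> \<le> x"
    unfolding k using assms by (cases "A i j") auto
  finally show ?thesis .
qed

text \<open>
  The gap between \<open>K\<close> and \<open>M\<close> is what distinguishes the slope of a finite total payment from the
  slopes \<open>\<plusminus> M\<close>.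
\<close>

locale certified_game =
  fixes A B :: "'m::finite \<Rightarrow> 'j::finite \<Rightarrow> ereal"
    and K M :: real and g h :: "'j \<Rightarrow> real" and t\<^sub>0 :: real
    and \<sigma> :: "'j \<Rightarrow> 'm \<Rightarrow> 'j" and \<tau> :: "'j \<Rightarrow> 'm"
  assumes A: "\<And>i j. A i j \<noteq> \<infinity>" and B: "\<And>i j. B i j \<noteq> \<infinity>"
    and payment_bound: "\<And>j i k. \<bar>payment A B j i k\<bar> \<le> K"
    and K_less_M: "K < M"
    and max_cert: "max_certificate A B M g h t\<^sub>0 \<sigma>"
    and min_cert: "min_certificate A B M g h t\<^sub>0 \<tau>"
begin

lemma M_pos: "0 < M"
  using payment_bound[of undefined undefined undefined] K_less_M by linarith

lemma payment_add:
  assumes "A i j \<noteq> -\<infinity>" "B i k \<noteq> -\<infinity>"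
  shows "- A i j + (B i k + y) = ereal (payment A B j i k) + y"
  using assms A[of i j] B[of i k]
  by (cases "A i j"; cases "B i k"; cases y) (auto simp: payment_def)

lemma potential_bounded: "\<exists>C. \<forall>j. \<bar>h j + t\<^sub>0 * g j\<bar> \<le> C"
  by (rule exI[of _ "Max (range (\<lambda>j. \<bar>h j + t\<^sub>0 * g j\<bar>))"]) auto

text \<open>
  An iterate is the total payment along one play of \<open>N\<close> turns: it is infinite or a sum of at most
  \<open>N\<close> finite payments.
\<close>

lemma dp_iterate_bounded:
  "\<bar>(dp_operator A B ^^ N) (\<lambda>_. 0) j\<bar> = \<infinity> \<or>
   \<bar>(dp_operator A B ^^ N) (\<lambda>_. 0) j\<bar> \<le> ereal (real N * K)"
proof (induction N arbitrary: j)
  case (Suc N)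
  let ?y = "(dp_operator A B ^^ N) (\<lambda>_. 0)"
  obtain i k where ik: "dp_operator A B ?y j =
    (if A i j = -\<infinity> then \<infinity> else if B i k = -\<infinity> then -\<infinity> else - A i j + (B i k + ?y k))"
    using dp_operator_attained[of A B ?y j] A by blast
  show ?case
  proof (cases "A i j = -\<infinity> \<or> B i k = -\<infinity>")
    case False
    then have "dp_operator A B ?y j = ereal (payment A B j i k) + ?y k"
      using ik payment_add[of i j k "?y k"] by simp
    then show ?thesis
      using Suc.IH[of k] payment_bound[of j i k] by (cases "?y k") (auto simp: algebra_simps)
  qed (use ik in auto)
qed simp

text \<open>
  The constant makes the potential \<open>h + t\<^sub>0 g - C\<close> lie below the start \<open>0\<close> of the iteration. By
  monotonicity the potential stays below, since the operator maps it above the potential for \<open>t + 1\<close>.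
\<close>

lemma dp_iterate_ge:
  assumes C: "\<And>j. \<bar>h j + t\<^sub>0 * g j\<bar> \<le> C" and "- M < g j"
  shows "ereal (h j + (t\<^sub>0 + real N) * g j - C) \<le> (dp_operator A B ^^ N) (\<lambda>_. 0) j"
  using assms(2)
proof (induction N arbitrary: j)
  case 0
  then show ?case using C[of j] by (simp add: abs_le_iff)
next
  case (Suc N)
  show ?case unfolding funpow.simps comp_apply
  proof (rule dp_operator_ge)
    fix i assume i: "A i j \<noteq> -\<infinity>"
    define k where "k = \<sigma> j i"
    have k: "B i k \<noteq> -\<infinity>" "g j \<le> g k"
      and step: "h j + (t\<^sub>0 + real N + 1) * g j \<le> payment A B j i k + (h k + (t\<^sub>0 + real N) * g k)"
      using max_cert i Suc.prems unfolding max_certificate_def k_def by auto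
    let ?y = "(dp_operator A B ^^ N) (\<lambda>_. 0) k"
    have "ereal (h j + (t\<^sub>0 + real (Suc N)) * g j - C)
        \<le> ereal (payment A B j i k) + ereal (h k + (t\<^sub>0 + real N) * g k - C)"
      using step by (simp add: algebra_simps)
    also have "\<dots> \<le> ereal (payment A B j i k) + ?y"
      using Suc.IH[of k] k(2) Suc.prems by (intro add_left_mono) auto
    also have "\<dots> = - A i j + (B i k + ?y)"
      using payment_add[OF i k(1)] by simp
    finally show "\<exists>k. B i k \<noteq> -\<infinity> \<and> ereal (h j + (t\<^sub>0 + real (Suc N)) * g j - C)
        \<le> - A i j + (B i k + (dp_operator A B ^^ N) (\<lambda>_. 0) k)"
      using k by blast
  qed
qed

lemma dp_iterate_le:
  assumes C: "\<And>j. \<bar>h j + t\<^sub>0 * g j\<bar> \<le> C" and "g j < M"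
  shows "(dp_operator A B ^^ N) (\<lambda>_. 0) j \<le> ereal (h j + (t\<^sub>0 + real N) * g j + C)"
  using assms(2)
proof (induction N arbitrary: j)
  case 0
  then show ?case using C[of j] by (simp add: abs_le_iff)
next
  case (Suc N)
  define i where "i = \<tau> j"
  have i: "A i j \<noteq> -\<infinity>"
    using min_cert Suc.prems unfolding min_certificate_def i_def by auto
  show ?case unfolding funpow.simps comp_apply
  proof (rule dp_operator_le[of A i])
    show "\<bar>A i j\<bar> \<noteq> \<infinity>" using i A by auto
    fix k assume k: "B i k \<noteq> -\<infinity>"
    have gk: "g k \<le> g j"
      and step: "payment A B j i k + (h k + (t\<^sub>0 + real N) * g k) \<le> h j + (t\<^sub>0 + real N + 1) * g j"
      using min_cert k Suc.prems unfolding min_certificate_def i_def by auto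
    let ?y = "(dp_operator A B ^^ N) (\<lambda>_. 0) k"
    have "- A i j + (B i k + ?y) = ereal (payment A B j i k) + ?y"
      by (rule payment_add[OF i k])
    also have "\<dots> \<le> ereal (payment A B j i k) + ereal (h k + (t\<^sub>0 + real N) * g k + C)"
      using Suc.IH[of k] gk Suc.prems by (intro add_left_mono) auto
    also have "\<dots> \<le> ereal (h j + (t\<^sub>0 + real (Suc N)) * g j + C)"
      using step by (simp add: algebra_simps)
    finally show "- A i j + (B i k + ?y) \<le> ereal (h j + (t\<^sub>0 + real (Suc N)) * g j + C)" .
  qed
qed

theorem mean_iterate_tendsto: "mean_iterate A B j \<longlonglongrightarrow> growth_value M (g j)"
proof -
  obtain C where C: "\<And>j. \<bar>h j + t\<^sub>0 * g j\<bar> \<le> C" using potential_bounded by blast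
  let ?X = "\<lambda>N. (dp_operator A B ^^ N) (\<lambda>_. 0) j"
  have "growth_value M (g j) \<le> liminf (\<lambda>N. ?X N / ereal (real N))"
  proof (rule liminf_average_ge[OF M_pos K_less_M dp_iterate_bounded, where C = "2 * C"])
    fix N assume "- M < g j"
    have "real N * g j - 2 * C \<le> h j + (t\<^sub>0 + real N) * g j - C"
      using C[of j] by (simp add: abs_le_iff algebra_simps)
    then show "ereal (real N * g j - 2 * C) \<le> ?X N"
      using dp_iterate_ge[OF C \<open>- M < g j\<close>, of N] by (meson ereal_less_eq(3) order_trans)
  qed
  moreover have "limsup (\<lambda>N. ?X N / ereal (real N)) \<le> growth_value M (g j)"
  proof (rule limsup_average_le[OF M_pos K_less_M dp_iterate_bounded, where C = "2 * C"])
    fix N assume "g j < M"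
    have "h j + (t\<^sub>0 + real N) * g j + C \<le> real N * g j + 2 * C"
      using C[of j] by (simp add: abs_le_iff algebra_simps)
    then show "?X N \<le> ereal (real N * g j + 2 * C)"
      using dp_iterate_le[OF C \<open>g j < M\<close>, of N] by (meson ereal_less_eq(3) order_trans)
  qed
  moreover have "liminf (\<lambda>N. ?X N / ereal (real N)) \<le> limsup (\<lambda>N. ?X N / ereal (real N))"
    by (rule Liminf_le_Limsup) simp
  ultimately show ?thesis
    unfolding mean_iterate_def[abs_def] by (intro Liminf_eq_Limsup antisym) auto
qed

section \<open>The value of the game\<close>

lemma total_payment_bounded:
  "\<bar>total_payment A B s u j\<^sub>0 N\<bar> = \<infinity> \<or> \<bar>total_payment A B s u j\<^sub>0 N\<bar> \<le> ereal (real N * K)"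
proof (induction N)
  case (Suc N)
  let ?X = "total_payment A B s u j\<^sub>0 N"
  obtain hist j where p: "play s u j\<^sub>0 N = (hist, j)" by fastforce
  define i where "i = u hist j"
  define k where "k = s hist j i"
  have turn: "turn_payment A B s u j\<^sub>0 N =
      (if A i j = -\<infinity> then \<infinity> else if B i k = -\<infinity> then -\<infinity> else - A i j + B i k)"
    unfolding turn_payment_def p i_def k_def by (simp add: Let_def)
  show ?case
  proof (cases "\<bar>?X\<bar> = \<infinity> \<or> A i j = -\<infinity> \<or> B i k = -\<infinity>")
    case False
    then have "turn_payment A B s u j\<^sub>0 N = ereal (payment A B j i k)"
      using turn payment_add[of i j k 0] by simp
    then show ?thesis
      using False Suc.IH payment_bound[of j i k] by (cases ?X) (auto simp: algebra_simps)
  qed (auto simp: turn)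
qed simp

text \<open>
  The policies of the certificates, completed to legal strategies where a certificate does not
  apply.
\<close>

definition max_optimal :: "('m, 'j) max_strategy" where
  "max_optimal hist j i = (if B i (\<sigma> j i) \<noteq> -\<infinity> then \<sigma> j i else SOME k. B i k \<noteq> -\<infinity>)"

definition min_optimal :: "('m, 'j) min_strategy" where
  "min_optimal hist j = (if A (\<tau> j) j \<noteq> -\<infinity> then \<tau> j else SOME i. A i j \<noteq> -\<infinity>)"

lemma max_optimal_legal: "max_optimal \<in> max_strategies B"
  unfolding max_strategies_def max_optimal_def
  by simp (metis (mono_tags, lifting) someI_ex)

lemma min_optimal_legal: "min_optimal \<in> min_strategies A"
  unfolding min_strategies_def min_optimal_def
  by simp (metis (mono_tags, lifting) someI_ex)

text \<open>
  Telescoping along a play: the claim for \<open>N + 1\<close> and \<open>t\<close> uses the one for \<open>N\<close> and \<open>t + 1\<close>, which is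
  why \<open>t\<close> is quantified inside. The monotonicity of \<open>g\<close> keeps the play in the region of Max's
  certificate, so Max always has a move and the game can end only by Min being stuck.
\<close>

lemma max_optimal_potential:
  assumes "- M < g j\<^sub>0"
  shows "total_payment A B max_optimal u j\<^sub>0 N = \<infinity> \<or>
    (\<exists>x. total_payment A B max_optimal u j\<^sub>0 N = ereal x \<and>
      (let j = snd (play max_optimal u j\<^sub>0 N) in g j\<^sub>0 \<le> g j \<and>
        (\<forall>t\<ge>t\<^sub>0. h j\<^sub>0 + (t + real N) * g j\<^sub>0 \<le> x + (h j + t * g j))))"
proof (induction N)
  case (Suc N)
  let ?X = "total_payment A B max_optimal u j\<^sub>0 N"
  obtain hist j where p: "play max_optimal u j\<^sub>0 N = (hist, j)" by fastforce
  define i where "i = u hist j"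
  define k where "k = max_optimal hist j i"
  have turn: "turn_payment A B max_optimal u j\<^sub>0 N =
      (if A i j = -\<infinity> then \<infinity> else if B i k = -\<infinity> then -\<infinity> else - A i j + B i k)"
    unfolding turn_payment_def p i_def k_def by (simp add: Let_def)
  have next_state: "snd (play max_optimal u j\<^sub>0 (Suc N)) = k"
    using p by (simp add: i_def k_def Let_def)
  show ?case
  proof (cases "?X = \<infinity>")
    case False
    then obtain x where x: "?X = ereal x" and g: "g j\<^sub>0 \<le> g j"
      and pot: "\<forall>t\<ge>t\<^sub>0. h j\<^sub>0 + (t + real N) * g j\<^sub>0 \<le> x + (h j + t * g j)"
      using Suc.IH p by (auto simp: Let_def)
    show ?thesis
    proof (cases "A i j = -\<infinity>")
      case False
      have "- M < g j" using assms g by linarith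
      with False have legal: "B i (\<sigma> j i) \<noteq> -\<infinity>"
        and step: "g j \<le> g (\<sigma> j i)" "\<And>t. t \<ge> t\<^sub>0 \<Longrightarrow>
          h j + (t + 1) * g j \<le> payment A B j i (\<sigma> j i) + (h (\<sigma> j i) + t * g (\<sigma> j i))"
        using max_cert unfolding max_certificate_def by auto
      have k: "k = \<sigma> j i" using legal by (simp add: k_def max_optimal_def)
      have "turn_payment A B max_optimal u j\<^sub>0 N = ereal (payment A B j i k)"
        using turn False legal payment_add[of i j k 0] by (simp add: k)
      then have "total_payment A B max_optimal u j\<^sub>0 (Suc N) = ereal (x + payment A B j i k)"
        using x by simp
      moreover have "h j\<^sub>0 + (t + real (Suc N)) * g j\<^sub>0 \<le> x + payment A B j i k + (h k + t * g k)"
        if "t \<ge> t\<^sub>0" for t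
        using pot[rule_format, of "t + 1"] step(2)[OF that] that unfolding k
        by (simp add: algebra_simps)
      moreover have "g j\<^sub>0 \<le> g k" using g step(1) unfolding k by linarith
      ultimately show ?thesis unfolding next_state Let_def by blast
    qed (use x turn in simp)
  qed simp
qed (simp add: Let_def)

text \<open>The same telescoping for Min; here the game can end only by Max being stuck.\<close>

lemma min_optimal_potential:
  assumes "g j\<^sub>0 < M"
  shows "total_payment A B s min_optimal j\<^sub>0 N = -\<infinity> \<or>
    (\<exists>x. total_payment A B s min_optimal j\<^sub>0 N = ereal x \<and>
      (let j = snd (play s min_optimal j\<^sub>0 N) in g j \<le> g j\<^sub>0 \<and>
        (\<forall>t\<ge>t\<^sub>0. x + (h j + t * g j) \<le> h j\<^sub>0 + (t + real N) * g j\<^sub>0)))"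
proof (induction N)
  case (Suc N)
  let ?X = "total_payment A B s min_optimal j\<^sub>0 N"
  obtain hist j where p: "play s min_optimal j\<^sub>0 N = (hist, j)" by fastforce
  define i where "i = min_optimal hist j"
  define k where "k = s hist j i"
  have turn: "turn_payment A B s min_optimal j\<^sub>0 N =
      (if A i j = -\<infinity> then \<infinity> else if B i k = -\<infinity> then -\<infinity> else - A i j + B i k)"
    unfolding turn_payment_def p i_def k_def by (simp add: Let_def)
  have next_state: "snd (play s min_optimal j\<^sub>0 (Suc N)) = k"
    using p by (simp add: i_def k_def Let_def)
  show ?case
  proof (cases "?X = -\<infinity>")
    case False
    then obtain x where x: "?X = ereal x" and g: "g j \<le> g j\<^sub>0"
      and pot: "\<forall>t\<ge>t\<^sub>0. x + (h j + t * g j) \<le> h j\<^sub>0 + (t + real N) * g j\<^sub>0"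
      using Suc.IH p by (auto simp: Let_def)
    have "g j < M" using assms g by linarith
    then have legal: "A (\<tau> j) j \<noteq> -\<infinity>"
      using min_cert unfolding min_certificate_def by auto
    have i: "i = \<tau> j" using legal by (simp add: i_def min_optimal_def)
    show ?thesis
    proof (cases "B i k = -\<infinity>")
      case False
      then have step: "g k \<le> g j"
          "\<And>t. t \<ge> t\<^sub>0 \<Longrightarrow> payment A B j i k + (h k + t * g k) \<le> h j + (t + 1) * g j"
        using min_cert \<open>g j < M\<close> unfolding min_certificate_def i by auto
      have "turn_payment A B s min_optimal j\<^sub>0 N = ereal (payment A B j i k)"
        using turn False legal payment_add[of i j k 0] by (simp add: i)
      then have "total_payment A B s min_optimal j\<^sub>0 (Suc N) = ereal (x + payment A B j i k)"
        using x by simp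
      moreover have "x + payment A B j i k + (h k + t * g k) \<le> h j\<^sub>0 + (t + real (Suc N)) * g j\<^sub>0"
        if "t \<ge> t\<^sub>0" for t
        using pot[rule_format, of "t + 1"] step(2)[OF that] that by (simp add: algebra_simps)
      moreover have "g k \<le> g j\<^sub>0" using g step(1) by linarith
      ultimately show ?thesis unfolding next_state Let_def by blast
    qed (use x turn legal i in simp)
  qed simp
qed (simp add: Let_def)

lemma max_optimal_guarantees: "growth_value M (g j) \<le> mean_payoff A B max_optimal u j"
proof -
  obtain C where C: "\<And>j. \<bar>h j + t\<^sub>0 * g j\<bar> \<le> C" using potential_bounded by blast
  have "growth_value M (g j) \<le> liminf (\<lambda>N. total_payment A B max_optimal u j N / ereal (real N))"
  proof (rule liminf_average_ge[OF M_pos K_less_M total_payment_bounded, where C = "2 * C"])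
    fix N assume j: "- M < g j"
    let ?k = "snd (play max_optimal u j N)"
    show "ereal (real N * g j - 2 * C) \<le> total_payment A B max_optimal u j N"
    proof (cases "total_payment A B max_optimal u j N = \<infinity>")
      case False
      then obtain x where x: "total_payment A B max_optimal u j N = ereal x"
        and "h j + (t\<^sub>0 + real N) * g j \<le> x + (h ?k + t\<^sub>0 * g ?k)"
        using max_optimal_potential[OF j, of u N] by (auto simp: Let_def)
      then have "real N * g j - 2 * C \<le> x"
        using C[of j] C[of ?k] by (simp add: abs_le_iff algebra_simps)
      then show ?thesis using x by simp
    qed simp
  qed
  also have "\<dots> \<le> mean_payoff A B max_optimal u j"
    unfolding mean_payoff_def by (rule Liminf_le_Limsup) simp
  finally show ?thesis .
qed

lemma min_optimal_guarantees: "mean_payoff A B s min_optimal j \<le> growth_value M (g j)"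
proof -
  obtain C where C: "\<And>j. \<bar>h j + t\<^sub>0 * g j\<bar> \<le> C" using potential_bounded by blast
  show ?thesis unfolding mean_payoff_def
  proof (rule limsup_average_le[OF M_pos K_less_M total_payment_bounded, where C = "2 * C"])
    fix N assume j: "g j < M"
    let ?k = "snd (play s min_optimal j N)"
    show "total_payment A B s min_optimal j N \<le> ereal (real N * g j + 2 * C)"
    proof (cases "total_payment A B s min_optimal j N = -\<infinity>")
      case False
      then obtain x where x: "total_payment A B s min_optimal j N = ereal x"
        and "x + (h ?k + t\<^sub>0 * g ?k) \<le> h j + (t\<^sub>0 + real N) * g j"
        using min_optimal_potential[OF j, of s N] by (auto simp: Let_def)
      then have "x \<le> real N * g j + 2 * C"
        using C[of j] C[of ?k] by (simp add: abs_le_iff algebra_simps)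
      then show ?thesis using x by simp
    qed simp
  qed
qed

theorem game_value: "is_game_value A B j (growth_value M (g j))"
proof -
  let ?p = "\<lambda>s u. mean_payoff A B s u j"
  let ?lower = "SUP s\<in>max_strategies B. INF u\<in>min_strategies A. ?p s u"
  let ?upper = "INF u\<in>min_strategies A. SUP s\<in>max_strategies B. ?p s u"
  have "growth_value M (g j) \<le> (INF u\<in>min_strategies A. ?p max_optimal u)"
    by (rule INF_greatest) (rule max_optimal_guarantees)
  also have "\<dots> \<le> ?lower" by (rule SUP_upper) (rule max_optimal_legal)
  finally have 1: "growth_value M (g j) \<le> ?lower" .
  have "?upper \<le> (SUP s\<in>max_strategies B. ?p s min_optimal)"
    by (rule INF_lower) (rule min_optimal_legal)
  also have "\<dots> \<le> growth_value M (g j)" by (rule SUP_least) (rule min_optimal_guarantees)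
  finally have 2: "?upper \<le> growth_value M (g j)" .
  have "?lower \<le> ?upper"
    by (intro SUP_least INF_greatest) (meson INF_lower SUP_upper order_trans)
  then show ?thesis unfolding is_game_value_def using 1 2 by auto
qed

lemma chi_eq: "chi A B j = growth_value M (g j)"
  unfolding chi_def using mean_iterate_tendsto by (rule limI)

section \<open>Tropical subsolutions\<close>

text \<open>
  The condition on \<open>y\<close> in the next two theorems is \<open>y \<le> f(y)\<close> with \<open>A i j\<close> moved to the left-hand
  side. From a state with \<open>g \<ge> 0\<close>, Max's certified move leads to a state with \<open>g \<ge> 0\<close>, so cutting
  \<open>h + t\<^sub>0 g\<close> off to \<open>-\<infinity>\<close> elsewhere removes no \<open>k\<close> that is needed; and \<open>h + t\<^sub>0 g \<le> h + (t\<^sub>0 + 1) g\<close>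
  there. States of value \<open>\<infinity>\<close> get a finite entry, because \<open>g\<close> is finite.
\<close>

theorem chi_nonneg_imp_subsolution:
  assumes "0 \<le> chi A B j\<^sub>0"
  shows "\<exists>y. (\<forall>j. y j \<noteq> \<infinity>) \<and> y j\<^sub>0 \<noteq> -\<infinity> \<and>
    (\<forall>i j. A i j + y j \<noteq> -\<infinity> \<longrightarrow> (\<exists>k. A i j + y j \<le> B i k + y k))"
proof -
  define y where "y j = (if 0 \<le> g j then ereal (h j + t\<^sub>0 * g j) else -\<infinity>)" for j
  have "0 \<le> g j\<^sub>0"
    using assms M_pos unfolding chi_eq growth_value_def by (auto split: if_splits)
  moreover have "\<exists>k. A i j + y j \<le> B i k + y k" if "A i j + y j \<noteq> -\<infinity>" for i j
  proof -
    have ij: "A i j \<noteq> -\<infinity>" "0 \<le> g j"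
      using that A[of i j] by (auto simp: y_def split: if_splits)
    define k where "k = \<sigma> j i"
    have k: "B i k \<noteq> -\<infinity>" "0 \<le> g k"
      and step: "h j + (t\<^sub>0 + 1) * g j \<le> payment A B j i k + (h k + t\<^sub>0 * g k)"
      using max_cert ij M_pos unfolding max_certificate_def k_def by force+
    have "h j + t\<^sub>0 * g j \<le> payment A B j i k + (h k + t\<^sub>0 * g k)"
      using step ij(2) by (simp add: algebra_simps)
    then have "A i j + y j \<le> B i k + y k"
      using ij k A[of i j] B[of i k] unfolding y_def payment_def
      by (cases "A i j"; cases "B i k") auto
    then show ?thesis by blast
  qed
  ultimately show ?thesis by (intro exI[of _ y]) (auto simp: y_def)
qed

text \<open>By monotonicity the subsolution \<open>y - C \<le> 0\<close> stays below all iterates of \<open>0\<close>.\<close>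

theorem subsolution_imp_chi_nonneg:
  assumes y: "\<And>j. y j \<noteq> \<infinity>" "y j\<^sub>0 \<noteq> -\<infinity>"
    and sub: "\<And>i j. A i j + y j \<noteq> -\<infinity> \<Longrightarrow> \<exists>k. A i j + y j \<le> B i k + y k"
  shows "0 \<le> chi A B j\<^sub>0"
proof -
  obtain C where C: "\<And>j. y j \<le> ereal C"
  proof
    fix j
    have "real_of_ereal (y j) \<le> Max (range (\<lambda>j. real_of_ereal (y j)))" by (rule Max_ge) auto
    then show "y j \<le> ereal (Max (range (\<lambda>j. real_of_ereal (y j))))"
      using y(1)[of j] by (cases "y j") (simp_all del: Max_ge_iff)
  qed
  have iterate: "y j - ereal C \<le> (dp_operator A B ^^ N) (\<lambda>_. 0) j" for N j
  proof (induction N arbitrary: j)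
    case 0
    then show ?case using C[of j] by (cases "y j") auto
  next
    case (Suc N)
    show ?case
    proof (cases "y j = -\<infinity>")
      case False
      show ?thesis unfolding funpow.simps comp_apply
      proof (rule dp_operator_ge)
        fix i assume i: "A i j \<noteq> -\<infinity>"
        obtain k where k: "A i j + y j \<le> B i k + y k"
          using sub[of i j] i False by (cases "A i j"; cases "y j") auto
        have "B i k \<noteq> -\<infinity>"
          using k i False y(1)[of k] by (cases "A i j"; cases "y j"; cases "y k") auto
        have "y j - ereal C \<le> ereal (payment A B j i k) + (y k - ereal C)"
          using k i False \<open>B i k \<noteq> -\<infinity>\<close> A[of i j] B[of i k] y(1)[of j] y(1)[of k] unfolding payment_def
          by (cases "A i j"; cases "B i k"; cases "y j"; cases "y k") auto
        also have "\<dots> \<le> ereal (payment A B j i k) + (dp_operator A B ^^ N) (\<lambda>_. 0) k"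
          using Suc.IH[of k] by (rule add_left_mono)
        also have "\<dots> = - A i j + (B i k + (dp_operator A B ^^ N) (\<lambda>_. 0) k)"
          by (rule payment_add[OF i \<open>B i k \<noteq> -\<infinity>\<close>, symmetric])
        finally show "\<exists>k. B i k \<noteq> -\<infinity> \<and>
            y j - ereal C \<le> - A i j + (B i k + (dp_operator A B ^^ N) (\<lambda>_. 0) k)"
          using \<open>B i k \<noteq> -\<infinity>\<close> by blast
      qed
    qed simp
  qed
  obtain b where b: "y j\<^sub>0 = ereal b" using y by (metis real_of_ereal.cases)
  have "growth_value M 0 \<le> liminf (\<lambda>N. (dp_operator A B ^^ N) (\<lambda>_. 0) j\<^sub>0 / ereal (real N))"
  proof (rule liminf_average_ge[OF M_pos K_less_M dp_iterate_bounded, where C = "C - b"])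
    show "ereal (real N * 0 - (C - b)) \<le> (dp_operator A B ^^ N) (\<lambda>_. 0) j\<^sub>0" for N
      using iterate[of j\<^sub>0 N] b by simp
  qed
  also have "\<dots> = growth_value M (g j\<^sub>0)"
    using lim_imp_Liminf[OF _ mean_iterate_tendsto[of j\<^sub>0]] by (simp add: mean_iterate_def[abs_def])
  finally show ?thesis using M_pos unfolding chi_eq by (simp add: growth_value_def split: if_splits)
qed

end

lemma certified_game_exists:
  fixes A B :: "'m::finite \<Rightarrow> 'j::finite \<Rightarrow> ereal"
  assumes "\<And>i j. A i j \<noteq> \<infinity>" and "\<And>i j. B i j \<noteq> \<infinity>"
  shows "\<exists>K M g h t\<^sub>0 \<sigma> \<tau>. certified_game A B K M g h t\<^sub>0 \<sigma> \<tau>"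
proof -
  define K where "K = Max (range (\<lambda>(j, i, k). \<bar>payment A B j i k\<bar>))"
  have K: "\<bar>payment A B j i k\<bar> \<le> K" for j i k
    unfolding K_def by (rule Max_ge) (auto intro: image_eqI[of _ _ "(j, i, k)"])
  then have "\<bar>payment A B j i k\<bar> \<le> K + 1" for j i k
    by (rule order_trans) simp
  from certificates_exist[of A B, OF this] show ?thesis
    unfolding certified_game_def using assms K by (metis less_add_one)
qed

text \<open>
  Homogenisation: a point of the polyhedron is a solution of the homogeneous system with last
  coordinate \<open>0\<close>, and a solution with finite last coordinate can be normalised by subtracting it.
\<close>

lemma tropical_polyhedron_nonempty_iff:
  fixes A B :: "'m::finite \<Rightarrow> 'n::finite \<Rightarrow> ereal"
  assumes A: "\<And>i j. A i j \<noteq> \<infinity>" and B: "\<And>i j. B i j \<noteq> \<infinity>"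
    and c: "\<And>i. c i \<noteq> \<infinity>" and d: "\<And>i. d i \<noteq> \<infinity>"
  shows "tropical_polyhedron A B c d \<noteq> {} \<longleftrightarrow>
    (\<exists>y. (\<forall>j. y j \<noteq> \<infinity>) \<and> y None \<noteq> -\<infinity> \<and> (\<forall>i j. append_col A c i j + y j \<noteq> -\<infinity> \<longrightarrow>
      (\<exists>k. append_col A c i j + y j \<le> append_col B d i k + y k)))"
    (is "_ \<longleftrightarrow> (\<exists>y. ?sub y)")
proof
  assume "tropical_polyhedron A B c d \<noteq> {}"
  then obtain x where x: "\<And>j. x j \<noteq> \<infinity>"
    and le: "\<And>i. max (MAX j. A i j + x j) (c i) \<le> max (MAX j. B i j + x j) (d i)"
    unfolding tropical_polyhedron_def by blast
  define y where "y = case_option 0 x"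
  have "\<exists>k. append_col A c i j + y j \<le> append_col B d i k + y k" for i j
  proof -
    have "\<exists>k. max (MAX j. B i j + x j) (d i) = append_col B d i k + y k"
    proof (cases "(MAX j. B i j + x j) \<le> d i")
      case True
      then show ?thesis by (intro exI[of _ None]) (simp add: append_col_def y_def max_def)
    next
      case False
      have "(MAX j. B i j + x j) \<in> range (\<lambda>j. B i j + x j)" by (rule Max_in) auto
      then obtain k where "(MAX j. B i j + x j) = B i k + x k" by blast
      then show ?thesis
        using False by (intro exI[of _ "Some k"]) (simp add: append_col_def y_def max_def)
    qed
    then obtain k where k: "max (MAX j. B i j + x j) (d i) = append_col B d i k + y k" by blast
    have "append_col A c i j + y j \<le> max (MAX j. A i j + x j) (c i)"
      by (cases j) (auto simp: append_col_def y_def intro: max.coboundedI1 Max_ge)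
    also note le
    also note k
    finally show ?thesis by blast
  qed
  then have "?sub y" using x by (auto simp: y_def split: option.split)
  then show "\<exists>y. ?sub y" by blast
next
  assume "\<exists>y. ?sub y"
  then obtain y where y: "\<And>j. y j \<noteq> \<infinity>" "y None \<noteq> -\<infinity>"
    and sub: "\<And>i j. append_col A c i j + y j \<noteq> -\<infinity> \<Longrightarrow>
      \<exists>k. append_col A c i j + y j \<le> append_col B d i k + y k" by blast
  obtain b where b: "y None = ereal b" using y by (metis real_of_ereal.cases)
  define x where "x j = y (Some j) - ereal b" for j
  have shift: "append_col F f i j + y j = ereal b + (case j of None \<Rightarrow> f i | Some k \<Rightarrow> F i k + x k)"
    for F :: "'m \<Rightarrow> 'n \<Rightarrow> ereal" and f i j
  proof (cases j)
    case (Some k)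
    then show ?thesis by (cases "y (Some k)"; cases "F i k") (auto simp: append_col_def x_def)
  qed (simp add: append_col_def b add.commute)
  let ?R = "\<lambda>i. max (MAX j. B i j + x j) (d i)"
  have entry: "(case j of None \<Rightarrow> c i | Some k \<Rightarrow> A i k + x k) \<le> ?R i" (is "?l \<le> _") for i j
  proof (cases "?l = -\<infinity>")
    case False
    then have "append_col A c i j + y j \<noteq> -\<infinity>" unfolding shift by (cases ?l) auto
    then obtain k where "append_col A c i j + y j \<le> append_col B d i k + y k" using sub by blast
    then have "?l \<le> (case k of None \<Rightarrow> d i | Some k \<Rightarrow> B i k + x k)"
      unfolding shift by (simp add: ereal_add_le_add_iff)
    also have "\<dots> \<le> ?R i"
      by (cases k) (auto intro: max.coboundedI1 Max_ge)
    finally show ?thesis .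
  qed simp
  have "(MAX j. A i j + x j) \<le> ?R i" for i
  proof (rule Max.boundedI)
    fix a assume "a \<in> range (\<lambda>j. A i j + x j)"
    then obtain j where "a = A i j + x j" by blast
    then show "a \<le> ?R i" using entry[where i = i and j = "Some j"] by (simp only: option.case)
  qed auto
  then have "max (MAX j. A i j + x j) (c i) \<le> ?R i" for i
    using entry[where i = i and j = None] by (simp only: max.bounded_iff option.case simp_thms)
  moreover have "x j \<noteq> \<infinity>" for j
    using y(1)[of "Some j"] unfolding x_def by (cases "y (Some j)") auto
  ultimately have "x \<in> tropical_polyhedron A B c d" unfolding tropical_polyhedron_def by blast
  then show "tropical_polyhedron A B c d \<noteq> {}" by blast
qed

theorem theorem3p5:
  fixes A B :: "'m::finite \<Rightarrow> 'n::finite \<Rightarrow> ereal"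
    and c d :: "'m \<Rightarrow> ereal"
  assumes "\<And>i j. A i j \<noteq> \<infinity>" and "\<And>i j. B i j \<noteq> \<infinity>"
    and "\<And>i. c i \<noteq> \<infinity>" and "\<And>i. d i \<noteq> \<infinity>"
  shows "convergent (mean_iterate (append_col A c) (append_col B d) None) \<and>
    is_game_value (append_col A c) (append_col B d) None
      (chi (append_col A c) (append_col B d) None) \<and>
    (tropical_polyhedron A B c d \<noteq> {} \<longleftrightarrow>
      0 \<le> chi (append_col A c) (append_col B d) None)"
proof -
  have finite: "append_col A c i j \<noteq> \<infinity>" "append_col B d i j \<noteq> \<infinity>" for i j
    using assms by (auto simp: append_col_def split: option.split)
  obtain K M g h t\<^sub>0 \<sigma> \<tau>
    where "certified_game (append_col A c) (append_col B d) K M g h t\<^sub>0 \<sigma> \<tau>"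
    using certified_game_exists[of "append_col A c" "append_col B d", OF finite] by blast
  then interpret certified_game "append_col A c" "append_col B d" K M g h t\<^sub>0 \<sigma> \<tau> .
  have "convergent (mean_iterate (append_col A c) (append_col B d) None)"
    using mean_iterate_tendsto by (rule convergentI)
  moreover have "is_game_value (append_col A c) (append_col B d) None
      (chi (append_col A c) (append_col B d) None)"
    unfolding chi_eq by (rule game_value)
  moreover have "tropical_polyhedron A B c d \<noteq> {} \<longleftrightarrow> 0 \<le> chi (append_col A c) (append_col B d) None"
    unfolding tropical_polyhedron_nonempty_iff[of A B c d, OF assms]
    using chi_nonneg_imp_subsolution[of None] subsolution_imp_chi_nonneg[of _ None] by blast
  ultimately show ?thesis by blast
qed

end
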